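(* Let $k$ be a positive integer and let $G$ be a finite, simple, undirected $2k$-regular graph with girth $g(G) \ge k$. Then $la(G) \le k+2$.
   Context: The girth $g(G)$ is the length of a shortest cycle in $G$. A linear forest is a graph in which every connected component is a path (a single vertex counts as a path). The linear arboricity $la(G)$ is the minimum number of linear forests whose edge sets partition the edge set $E(G)$. *)

theory Defs
  imports Main "HOL-Library.Extended_Nat" "HOL-Library.Disjoint_Sets"
begin

record 'a graph =
  verts :: "'a set"
  edges :: "'a set set"

definition simple_graph :: "'a graph \<Rightarrow> bool" where
  "simple_graph G \<longleftrightarrow> (\<forall>e\<in>edges G. e \<subseteq> verts G \<and> card e = 2)"

definition degree :: "'a graph \<Rightarrow> 'a \<Rightarrow> nat" where
  "degree G v = card {e \<in> edges G. v \<in> e}"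

definition regular :: "'a graph \<Rightarrow> nat \<Rightarrow> bool" where
  "regular G d \<longleftrightarrow> (\<forall>v\<in>verts G. degree G v = d)"

text \<open>A cycle is the list of its vertices, without repeating the first one at the end,
  so its length is the length of the list.\<close>

definition is_cycle :: "'a graph \<Rightarrow> 'a list \<Rightarrow> bool" where
  "is_cycle G vs \<longleftrightarrow> 3 \<le> length vs \<and> distinct vs \<and> set vs \<subseteq> verts G \<and>
     (\<forall>i<length vs. {vs ! i, vs ! (Suc i mod length vs)} \<in> edges G)"

text \<open>The girth of an acyclic graph is \<open>\<infinity>\<close>, the infimum of the empty set.\<close>

definition girth :: "'a graph \<Rightarrow> enat" where
  "girth G = (INF vs \<in> {vs. is_cycle G vs}. enat (length vs))"

definition adjacent_rel :: "'a graph \<Rightarrow> ('a \<times> 'a) set" where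
  "adjacent_rel G = {(u, v). {u, v} \<in> edges G}"

definition induced_subgraph :: "'a graph \<Rightarrow> 'a set \<Rightarrow> 'a graph" where
  "induced_subgraph G C = \<lparr>verts = C, edges = {e \<in> edges G. e \<subseteq> C}\<rparr>"

definition components :: "'a graph \<Rightarrow> 'a graph set" where
  "components G =
     (\<lambda>u. induced_subgraph G {v \<in> verts G. (u, v) \<in> (adjacent_rel G)\<^sup>*}) ` verts G"

definition is_path :: "'a graph \<Rightarrow> bool" where
  "is_path P \<longleftrightarrow> (\<exists>vs. vs \<noteq> [] \<and> distinct vs \<and> verts P = set vs \<and>
     edges P = {{vs ! i, vs ! Suc i} | i. Suc i < length vs})"

definition linear_forest :: "'a graph \<Rightarrow> bool" where
  "linear_forest F \<longleftrightarrow> simple_graph F \<and> (\<forall>C\<in>components F. is_path C)"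

text \<open>Some of the forests may be edgeless; this does not affect the minimum.
  The value is \<open>\<infinity>\<close> if there is no finite decomposition, which cannot
  happen for a finite simple graph.\<close>

definition linear_decomposition :: "'a graph \<Rightarrow> nat \<Rightarrow> (nat \<Rightarrow> 'a graph) \<Rightarrow> bool" where
  "linear_decomposition G m F \<longleftrightarrow> (\<forall>i<m. linear_forest (F i)) \<and>
     disjoint_family_on (\<lambda>i. edges (F i)) {..<m} \<and>
     (\<Union>i<m. edges (F i)) = edges G"

definition linear_arboricity :: "'a graph \<Rightarrow> enat" where
  "linear_arboricity G = (INF m \<in> {m. \<exists>F. linear_decomposition G m F}. enat m)"

end

theory Submission
  imports Defs Complex_Main "HOL-Combinatorics.Cycles" "HOL-Combinatorics.Orbits"
begin

text \<open>By Petersen's theorem \<open>G\<close> splits into \<open>k\<close> two-factors, whose cycles have length at least \<open>k\<close>.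
  Removing one edge from every cycle leaves \<open>k\<close> linear forests. Giving each edge the weight one over
  the length of its cycle puts total weight \<open>1\<close> on every cycle and at most \<open>2\<close> at every vertex.
  Iterated rounding, in the style of Kiraly, Lau and Singh, turns these weights into a set of removed
  edges that meets every cycle and has maximum degree at most \<open>3\<close>, since an edge lies in only two
  vertex constraints. A graph of maximum degree \<open>3\<close> is a union of two linear forests (Akiyama,
  Exoo, Harary). The same rounding lemma yields the balanced orientation and the perfect matchings
  that are needed for Petersen's theorem.\<close>

subsection \<open>Rounding with small degree violation\<close>

text \<open>The obstacle is to break the cycles of all \<open>k\<close> factors at once without
  crowding: every vertex lies on one cycle of each factor, and careless choices could remove up to
  \<open>2 * k\<close> edges there. The girth enters only at this point: it makes every weight at
  most \<open>1 / k\<close>, so the \<open>2 * k\<close> edges at a vertex carry load at most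
  \<open>2\<close>. Rounding drops a vertex constraint as soon as fewer than \<open>b + r\<close>
  elements of nonzero weight touch the vertex, for then even rounding all of them up to 1 exceeds
  \<open>b\<close> by at most \<open>r - 1\<close>. With \<open>b = r = 2\<close> this is degree
  \<open>3\<close>. With \<open>r = 1\<close> nothing is exceeded, which is why the same lemma is
  exact enough for orientations and perfect matchings, where counting turns the upper bounds into
  equalities.\<close>

lemma homogeneous_system:
  fixes a :: "'i \<Rightarrow> 'x \<Rightarrow> real"
  assumes "finite I" "finite N" "card I < card N"
  shows "\<exists>y. (\<exists>x\<in>N. y x \<noteq> 0) \<and> (\<forall>i\<in>I. (\<Sum>x\<in>N. a i x * y x) = 0)"
  using assms
proof (induction I arbitrary: N a rule: finite_induct)
  case empty
  then have "N \<noteq> {}" by auto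
  then show ?case by (intro exI[of _ "\<lambda>_. 1"]) auto
next
  case (insert i I)
  show ?case
  proof (cases "\<forall>x\<in>N. a i x = 0")
    case True
    obtain y where "\<exists>x\<in>N. y x \<noteq> 0" "\<forall>j\<in>I. (\<Sum>x\<in>N. a j x * y x) = 0"
      using insert.IH[of N a] insert.prems insert.hyps by auto
    with True show ?thesis by (intro exI[of _ y]) auto
  next
    case False
    then obtain x0 where x0: "x0 \<in> N" "a i x0 \<noteq> 0" by auto
    define M where "M = N - {x0}"
    have M: "finite M" "card I < card M" "x0 \<notin> M" "N = insert x0 M"
      using insert.prems insert.hyps x0 by (auto simp: M_def)
    \<comment> \<open>Gaussian elimination: equation \<open>i\<close> is solved for the unknown
      \<open>x0\<close> and substituted into the others.\<close>
    obtain y where y: "\<exists>x\<in>M. y x \<noteq> 0"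
      "\<forall>j\<in>I. (\<Sum>x\<in>M. (a j x - a j x0 * a i x / a i x0) * y x) = 0"
      using insert.IH[of M "\<lambda>j x. a j x - a j x0 * a i x / a i x0"] M by auto
    define s where "s = (\<Sum>x\<in>M. a i x * y x)"
    define z where "z = y(x0 := - s / a i x0)"
    have zM: "(\<Sum>x\<in>M. a j x * z x) = (\<Sum>x\<in>M. a j x * y x)" for j
      using M(3) by (intro sum.cong) (auto simp: z_def)
    have zN: "(\<Sum>x\<in>N. a j x * z x) = (\<Sum>x\<in>M. a j x * y x) - a j x0 * s / a i x0" for j
      using M by (simp add: zM) (simp add: z_def)
    have "(\<Sum>x\<in>N. a j x * z x) = 0" if "j \<in> I" for j
    proof -
      have "0 = (\<Sum>x\<in>M. a j x * y x - a j x0 / a i x0 * (a i x * y x))"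
        using y(2) that by (auto simp: algebra_simps)
      also have "\<dots> = (\<Sum>x\<in>M. a j x * y x) - a j x0 / a i x0 * s"
        by (simp add: sum_subtractf sum_distrib_left s_def)
      finally show ?thesis using zN[of j] by simp
    qed
    moreover have "(\<Sum>x\<in>N. a i x * z x) = 0"
      using zN[of i] x0 by (simp add: s_def)
    moreover have "\<exists>x\<in>N. z x \<noteq> 0" using y(1) M by (auto simp: z_def)
    ultimately show ?thesis by (intro exI[of _ z]) auto
  qed
qed

text \<open>A pair \<open>(s, d)\<close> is the slack of an inequality and its rate of change along
  a direction. The step length \<open>t\<close> is the smallest ratio \<open>s / (- d)\<close> over
  the decreasing slacks.\<close>

lemma first_tight_constraint:
  fixes J :: "(real \<times> real) set"
  assumes "finite J" "\<And>s d. (s, d) \<in> J \<Longrightarrow> s > 0" "(s0, d0) \<in> J" "d0 < 0"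
  obtains t where "\<And>s d. (s, d) \<in> J \<Longrightarrow> s + t * d \<ge> 0"
    "\<exists>(s, d)\<in>J. s + t * d = 0"
proof -
  define K where "K = (\<lambda>(s, d). s / (- d)) ` {(s, d) \<in> J. d < 0}"
  have "{(s, d) \<in> J. d < 0} \<subseteq> J" by auto
  then have K: "finite K" "K \<noteq> {}" using assms finite_subset unfolding K_def by blast+
  define t where "t = Min K"
  have "t \<in> K" using K by (simp add: t_def)
  then obtain s1 d1 where 1: "(s1, d1) \<in> J" "d1 < 0" "t = s1 / (- d1)" by (auto simp: K_def)
  have "t > 0" using 1 assms(2)[OF 1(1)] by (simp add: divide_pos_neg)
  have "s + t * d \<ge> 0" if "(s, d) \<in> J" for s d
  proof (cases "d < 0")
    case True
    then have "s / (- d) \<in> K" using that by (force simp: K_def)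
    then have "t \<le> s / (- d)" using K by (simp add: t_def)
    then show ?thesis using True by (simp add: field_simps)
  next
    case False
    then show ?thesis using \<open>t > 0\<close> assms(2)[OF that] by (simp add: add_nonneg_nonneg)
  qed
  moreover have "s1 + t * d1 = 0" using 1 by simp
  ultimately show ?thesis using that 1(1) by blast
qed

text \<open>The fibres of \<open>c\<close> are the classes from which elements must be chosen,
  \<open>inc x\<close> holds the \<open>r\<close> vertices burdened by choosing \<open>x\<close>,
  and \<open>b\<close> is the load allowed at a vertex. It is used with edge-endpoint incidences
  (class: the edge), with arcs (class: the tail, burden: the head), and with the edges of the
  two-factors (class: the cycle, burden: both ends).\<close>

locale partitioned_hypergraph =
  fixes X :: "'x set" and c :: "'x \<Rightarrow> 'c" and inc :: "'x \<Rightarrow> 'v set" and r b :: nat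
  assumes finite_X: "finite X"
    and card_inc: "x \<in> X \<Longrightarrow> card (inc x) = r"
    and r_pos: "r > 0"
begin

definition load :: "('x \<Rightarrow> real) \<Rightarrow> 'v \<Rightarrow> real" where
  "load w v = (\<Sum>x | x \<in> X \<and> v \<in> inc x. w x)"

definition active :: "('x \<Rightarrow> real) \<Rightarrow> 'v \<Rightarrow> 'x set" where
  "active w v = {x \<in> X. v \<in> inc x \<and> w x \<noteq> 0}"

text \<open>The second alternative for \<open>v\<close> is the dropped constraint: with so few
  active elements no later rounding can bring \<open>b + r\<close> of them to
  \<open>v\<close>.\<close>

definition feasible :: "('x \<Rightarrow> real) \<Rightarrow> bool" where
  "feasible w \<longleftrightarrow> (\<forall>x\<in>X. 0 \<le> w x \<and> w x \<le> 1) \<and>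
     (\<forall>x\<in>X. (\<Sum>y | y \<in> X \<and> c y = c x. w y) = 1) \<and>
     (\<forall>v. load w v \<le> real b \<or> card (active w v) < b + r)"

definition fractional :: "('x \<Rightarrow> real) \<Rightarrow> 'x set" where
  "fractional w = {x \<in> X. 0 < w x \<and> w x < 1}"

text \<open>These vertices still have a constraint in force but impose no equation; they count in
  the termination measure, while \<open>tight_verts\<close> supplies the equations.\<close>

definition slack_verts :: "('x \<Rightarrow> real) \<Rightarrow> 'v set" where
  "slack_verts w = {v \<in> \<Union>(inc ` X). b + r \<le> card (active w v) \<and> load w v < real b}"

definition tight_verts :: "('x \<Rightarrow> real) \<Rightarrow> 'v set" where
  "tight_verts w = {v \<in> \<Union>(inc ` X). b + r \<le> card (active w v) \<and> load w v = real b}"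

section \<open>Token counting: fractional elements against constraints\<close>

lemma finite_verts: "finite (\<Union>(inc ` X))"
  using finite_X card_inc r_pos by (auto intro!: card_ge_0_finite)

lemma finite_fractional: "finite (fractional w)"
  using finite_X by (simp add: fractional_def)

lemma finite_tight_verts: "finite (tight_verts w)"
  by (rule finite_subset[OF _ finite_verts]) (auto simp: tight_verts_def)

lemma finite_slack_verts: "finite (slack_verts w)"
  by (rule finite_subset[OF _ finite_verts]) (auto simp: slack_verts_def)

text \<open>An element of weight 1 in the class would leave nothing for the positive weight of
  \<open>x\<close>, so the whole unit sits on fractional elements.\<close>

lemma class_fractional_sum:
  assumes "feasible w" "x \<in> fractional w"
  shows "(\<Sum>y | y \<in> fractional w \<and> c y = c x. w y) = 1"
proof -
  let ?C = "{y. y \<in> X \<and> c y = c x}"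
  have x: "x \<in> X" "0 < w x" "w x < 1" using assms(2) by (auto simp: fractional_def)
  have sum1: "(\<Sum>y\<in>?C. w y) = 1" and w: "\<And>y. y \<in> X \<Longrightarrow> 0 \<le> w y \<and> w y \<le> 1"
    using assms(1) x by (auto simp: feasible_def)
  have "w y \<noteq> 1" if "y \<in> ?C" for y
  proof
    assume y: "w y = 1"
    then have "x \<noteq> y" using x by auto
    then have "w x + w y = sum w {x, y}" by simp
    also have "\<dots> \<le> sum w ?C" using x that finite_X w by (intro sum_mono2) auto
    finally show False using sum1 y x by simp
  qed
  then have "w y = 0" if "y \<in> ?C - {y. y \<in> fractional w \<and> c y = c x}" for y
    using that w[of y] by (force simp: fractional_def)
  then have "(\<Sum>y | y \<in> fractional w \<and> c y = c x. w y) = sum w ?C"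
    using finite_X by (intro sum.mono_neutral_left) (auto simp: fractional_def)
  with sum1 show ?thesis by simp
qed

text \<open>At least \<open>b + r\<close> active elements share a load of exactly \<open>b\<close>,
  so their deficits \<open>1 - w x\<close> add up to at least \<open>r\<close>; elements of weight 1
  contribute no deficit.\<close>

lemma tight_vertex_tokens:
  assumes "feasible w" "v \<in> tight_verts w"
  shows "(\<Sum>x | x \<in> fractional w \<and> v \<in> inc x. 1 - w x) \<ge> real r"
proof -
  have w: "\<And>y. y \<in> X \<Longrightarrow> 0 \<le> w y \<and> w y \<le> 1" using assms by (auto simp: feasible_def)
  have fin: "finite (active w v)" using finite_X by (simp add: active_def)
  have "load w v = sum w (active w v)"
    unfolding load_def using finite_X by (intro sum.mono_neutral_right) (auto simp: active_def)
  then have "real r \<le> (\<Sum>x\<in>active w v. 1 - w x)"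
    using assms(2) by (simp add: tight_verts_def sum_subtractf)
  also have "\<dots> = (\<Sum>x | x \<in> fractional w \<and> v \<in> inc x. 1 - w x)"
    using fin w by (intro sum.mono_neutral_right) (force simp: active_def fractional_def)+
  finally show ?thesis .
qed

lemma sum_swap_inc:
  fixes g :: "'x \<Rightarrow> real"
  assumes "N \<subseteq> X" "finite V" "\<And>x. x \<in> N \<Longrightarrow> inc x \<subseteq> V"
  shows "(\<Sum>v\<in>V. \<Sum>x | x \<in> N \<and> v \<in> inc x. g x) = real r * sum g N"
proof -
  have fN: "finite N" using assms(1) finite_X finite_subset by blast
  have "(\<Sum>v\<in>V. \<Sum>x | x \<in> N \<and> v \<in> inc x. g x) = (\<Sum>x\<in>N. \<Sum>v | v \<in> V \<and> v \<in> inc x. g x)"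
    by (rule sum.swap_restrict[OF assms(2) fN])
  also have "\<dots> = (\<Sum>x\<in>N. real r * g x)"
  proof (rule sum.cong[OF refl])
    fix x assume x: "x \<in> N"
    then have "{v. v \<in> V \<and> v \<in> inc x} = inc x" using assms(3) by auto
    then show "(\<Sum>v | v \<in> V \<and> v \<in> inc x. g x) = real r * g x"
      using card_inc x assms(1) by auto
  qed
  finally show ?thesis by (simp add: sum_distrib_left)
qed

lemma sum_classes:
  fixes g :: "'x \<Rightarrow> real"
  assumes "finite N"
  shows "(\<Sum>C\<in>c ` N. \<Sum>y | y \<in> N \<and> c y = C. g y) = sum g N"
  using sum.group[of N "c ` N" c g] assms by auto

text \<open>Every fractional \<open>x\<close> sends \<open>w x\<close> to its class and \<open>(1 - w x) / r\<close> to each of its \<open>r\<close> vertices: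
  one token in total, while each class and each tight vertex receives at least one.\<close>

lemma count_constraints:
  assumes "feasible w"
  shows "card (c ` fractional w) + card (tight_verts w) \<le> card (fractional w)"
    and "x0 \<in> fractional w \<Longrightarrow> v0 \<in> inc x0 \<Longrightarrow> v0 \<notin> tight_verts w \<Longrightarrow>
      card (c ` fractional w) + card (tight_verts w) < card (fractional w)"
proof -
  let ?N = "fractional w" and ?V = "\<Union>(inc ` X)" and ?T = "tight_verts w"
  define g where "g v = (\<Sum>x | x \<in> ?N \<and> v \<in> inc x. 1 - w x)" for v
  have N: "?N \<subseteq> X" by (auto simp: fractional_def)
  have pos: "0 < 1 - w x" if "x \<in> ?N" for x using that by (auto simp: fractional_def)
  have g0: "g v \<ge> 0" for v unfolding g_def by (rule sum_nonneg) (use pos in force)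
  have gT: "real r * card ?T \<le> sum g ?T"
    using sum_mono[of ?T "\<lambda>_. real r" g] tight_vertex_tokens[OF assms] by (simp add: g_def mult.commute)
  have "(\<Sum>C\<in>c ` ?N. \<Sum>y | y \<in> ?N \<and> c y = C. w y) = (\<Sum>C\<in>c ` ?N. 1)"
    by (intro sum.cong) (use class_fractional_sum[OF assms] in auto)
  then have sN: "sum w ?N = card (c ` ?N)"
    using sum_classes[OF finite_fractional, of w w] by simp
  have "sum g ?V = real r * (\<Sum>x\<in>?N. 1 - w x)"
    unfolding g_def by (rule sum_swap_inc[OF N finite_verts]) (use N in auto)
  then have gV: "sum g ?V = real r * (real (card ?N) - card (c ` ?N))"
    using sN by (simp add: sum_subtractf)
  have TV: "?T \<subseteq> ?V" by (auto simp: tight_verts_def)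
  have "sum g ?T \<le> sum g ?V" using TV g0 finite_verts by (intro sum_mono2) auto
  then have "real r * card ?T \<le> real r * (real (card ?N) - card (c ` ?N))"
    using gT gV by linarith
  then have "real (card ?T) \<le> real (card ?N) - card (c ` ?N)"
    using r_pos by simp
  then show "card (c ` ?N) + card ?T \<le> card ?N" by linarith
  \<comment> \<open>The tokens sent to \<open>v0\<close> are positive and are claimed by no
    constraint, so the count becomes strict.\<close>
  assume v0: "x0 \<in> ?N" "v0 \<in> inc x0" "v0 \<notin> ?T"
  have "0 < g v0" unfolding g_def
    by (rule sum_pos2[of _ x0]) (use v0 finite_fractional pos in \<open>auto intro: less_imp_le\<close>)
  moreover have "sum g ?T + g v0 = sum g (insert v0 ?T)"
    using v0 finite_tight_verts by simp
  moreover have "\<dots> \<le> sum g ?V"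
    using TV g0 finite_verts v0 N by (intro sum_mono2) auto
  ultimately have "real r * card ?T < real r * (real (card ?N) - card (c ` ?N))"
    using gT gV by linarith
  then have "real (card ?T) < real (card ?N) - card (c ` ?N)"
    using r_pos by simp
  then show "card (c ` ?N) + card ?T < card ?N" by linarith
qed

text \<open>\<open>count_constraints\<close> only guarantees as many unknowns as equations, which is
  one short of forcing a nonzero solution. If some fractional element touches a vertex that is not
  tight, the count is strict; otherwise the equations are dependent.\<close>

lemma kernel_direction:
  assumes "feasible w" "fractional w \<noteq> {}"
  obtains y where "\<exists>x\<in>fractional w. y x \<noteq> 0" "\<And>x. x \<notin> fractional w \<Longrightarrow> y x = 0"
    "\<And>x. (\<Sum>z | z \<in> X \<and> c z = c x. y z) = 0" "\<And>v. v \<in> tight_verts w \<Longrightarrow> load y v = 0"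
proof -
  let ?N = "fractional w" and ?T = "tight_verts w"
  have N: "?N \<subseteq> X" by (auto simp: fractional_def)
  have fT: "finite ?T" and fN: "finite ?N" by (rule finite_tight_verts finite_fractional)+
  define a :: "'c + 'v \<Rightarrow> 'x \<Rightarrow> real" where
    "a i x = (case i of Inl C \<Rightarrow> if c x = C then 1 else 0 | Inr v \<Rightarrow> if v \<in> inc x then 1 else 0)" for i x
  let ?I = "Inl ` c ` ?N \<union> Inr ` ?T"
  have cardI: "card ?I = card (c ` ?N) + card ?T"
    using fT fN by (subst card_Un_disjoint) (auto simp: card_image)
  have a_Inl: "(\<Sum>x\<in>?N. a (Inl C) x * y x) = (\<Sum>x | x \<in> ?N \<and> c x = C. y x)" for C y
    using fN by (intro sum.mono_neutral_cong_right) (auto simp: a_def)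
  have a_Inr: "(\<Sum>x\<in>?N. a (Inr v) x * y x) = (\<Sum>x | x \<in> ?N \<and> v \<in> inc x. y x)" for v y
    using fN by (intro sum.mono_neutral_cong_right) (auto simp: a_def)
  have "\<exists>y. (\<exists>x\<in>?N. y x \<noteq> 0) \<and> (\<forall>i\<in>?I. (\<Sum>x\<in>?N. a i x * y x) = 0)"
  proof (cases "\<exists>x0\<in>?N. \<not> inc x0 \<subseteq> ?T")
    case True
    then show ?thesis
      using count_constraints(2)[OF assms(1)] cardI fT fN by (intro homogeneous_system) auto
  next
    case False
    \<comment> \<open>The vertex equations now add up to \<open>r\<close> times the sum of the class equations,
      so one class equation is redundant.\<close>
    obtain x0 where x0: "x0 \<in> ?N" using assms(2) by auto
    let ?J = "?I - {Inl (c x0)}"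
    have "card ?J < card ?I" using x0 fT fN by (intro psubset_card_mono) auto
    then have "card ?J < card ?N" using cardI count_constraints(1)[OF assms(1)] by linarith
    then obtain y where y: "\<exists>x\<in>?N. y x \<noteq> 0" "\<forall>i\<in>?J. (\<Sum>x\<in>?N. a i x * y x) = 0"
      using homogeneous_system[of ?J ?N a] fT fN by auto
    have "real r * sum y ?N = (\<Sum>v\<in>?T. \<Sum>x | x \<in> ?N \<and> v \<in> inc x. y x)"
      using False by (intro sum_swap_inc[OF N fT, symmetric]) auto
    also have "\<dots> = 0" using y(2) by (intro sum.neutral) (auto simp flip: a_Inr)
    finally have "sum y ?N = 0" using r_pos by simp
    then have "(\<Sum>C\<in>c ` ?N. \<Sum>x\<in>?N. a (Inl C) x * y x) = 0"
      using sum_classes[OF fN, of y] by (simp add: a_Inl)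
    moreover have "(\<Sum>C\<in>c ` ?N. \<Sum>x\<in>?N. a (Inl C) x * y x) = (\<Sum>C\<in>{c x0}. \<Sum>x\<in>?N. a (Inl C) x * y x)"
      using fN x0 y(2) by (intro sum.mono_neutral_right) auto
    ultimately have "(\<Sum>x\<in>?N. a (Inl (c x0)) x * y x) = 0" by simp
    with y show ?thesis by (intro exI[of _ y]) auto
  qed
  then obtain y where y: "\<exists>x\<in>?N. y x \<noteq> 0" "\<forall>i\<in>?I. (\<Sum>x\<in>?N. a i x * y x) = 0" by auto
  define z where "z x = (if x \<in> ?N then y x else 0)" for x
  have z: "(\<Sum>x | x \<in> X \<and> P x. z x) = (\<Sum>x | x \<in> ?N \<and> P x. y x)" for P
    using N finite_X by (intro sum.mono_neutral_cong_right) (auto simp: z_def)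
  show ?thesis
  proof (rule that[of z])
    show "\<exists>x\<in>?N. z x \<noteq> 0" using y(1) by (auto simp: z_def)
    show "z x = 0" if "x \<notin> ?N" for x using that by (simp add: z_def)
    show "load z v = 0" if "v \<in> ?T" for v
      unfolding load_def z using y(2) that by (auto simp flip: a_Inr)
    show "(\<Sum>x' | x' \<in> X \<and> c x' = c x. z x') = 0" for x
    proof (cases "c x \<in> c ` ?N")
      case True
      then show ?thesis unfolding z using y(2) by (auto simp flip: a_Inl)
    next
      case False
      then have empty: "{x'. x' \<in> ?N \<and> c x' = c x} = {}"
        by (metis (mono_tags, lifting) Collect_empty_eq image_eqI)
      show ?thesis unfolding z empty by simp
    qed
  qed
qed

text \<open>Moving along the kernel direction until a first inequality becomes tight makes a weight
  integral or removes a vertex from the slack ones, and neither set gains members.\<close>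

lemma rounding_step:
  assumes "feasible w" "fractional w \<noteq> {}"
  obtains w' where "feasible w'"
    "card (fractional w') + card (slack_verts w') < card (fractional w) + card (slack_verts w)"
proof -
  let ?N = "fractional w"
  obtain y where y: "\<exists>x\<in>?N. y x \<noteq> 0" "\<And>x. x \<notin> ?N \<Longrightarrow> y x = 0"
    "\<And>x. (\<Sum>z | z \<in> X \<and> c z = c x. y z) = 0" "\<And>v. v \<in> tight_verts w \<Longrightarrow> load y v = 0"
    by (rule kernel_direction[OF assms]) (rule that)
  \<comment> \<open>Slacks and their rates for the bounds 0 and 1 on the fractional weights and for
    the bound \<open>b\<close> at slack vertices.\<close>
  define J where "J = (\<lambda>x. (w x, y x)) ` ?N \<union> (\<lambda>x. (1 - w x, - y x)) ` ?N \<union>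
    (\<lambda>v. (b - load w v, - load y v)) ` slack_verts w"
  obtain x1 where x1: "x1 \<in> ?N" "y x1 \<noteq> 0" using y(1) by auto
  have "\<exists>s d. (s, d) \<in> J \<and> d < 0"
  proof (cases "y x1 < 0")
    case True
    moreover have "(w x1, y x1) \<in> J" using x1 by (auto simp: J_def)
    ultimately show ?thesis by blast
  next
    case False
    then have "- y x1 < 0" using x1 by simp
    moreover have "(1 - w x1, - y x1) \<in> J" using x1 by (auto simp: J_def)
    ultimately show ?thesis by blast
  qed
  then obtain s0 d0 where 0: "(s0, d0) \<in> J" "d0 < 0" by auto
  have "finite J" using finite_fractional finite_slack_verts by (simp add: J_def)
  moreover have "s > 0" if "(s, d) \<in> J" for s d
    using that by (auto simp: J_def fractional_def slack_verts_def)
  ultimately obtain t where t: "\<And>s d. (s, d) \<in> J \<Longrightarrow> s + t * d \<ge> 0" "\<exists>(s, d)\<in>J. s + t * d = 0"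
    using first_tight_constraint[OF _ _ 0] by blast
  define w' where "w' x = w x + t * y x" for x
  have load': "load w' v = load w v + t * load y v" for v
    by (simp add: load_def w'_def sum.distrib sum_distrib_left)
  have w'_eq: "w' x = w x" if "x \<notin> ?N" for x using y(2)[OF that] by (simp add: w'_def)
  have w'_N: "0 \<le> w' x \<and> w' x \<le> 1" if "x \<in> ?N" for x
  proof -
    have "(w x, y x) \<in> J" "(1 - w x, - y x) \<in> J" using that by (auto simp: J_def)
    from this[THEN t(1)] show ?thesis by (simp add: w'_def)
  qed
  \<comment> \<open>Zero weights stay zero, so a dropped vertex constraint never has to be
    restored.\<close>
  have supp: "active w' v \<subseteq> active w v" for v
    using w'_eq by (force simp: active_def fractional_def)
  then have card_supp: "card (active w' v) \<le> card (active w v)" for v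
    using finite_X by (intro card_mono) (auto simp: active_def)
  have outside: "load z v = 0" if "v \<notin> \<Union>(inc ` X)" for z v
  proof -
    have empty: "{x. x \<in> X \<and> v \<in> inc x} = {}" using that by auto
    show ?thesis unfolding load_def empty by simp
  qed
  \<comment> \<open>Two facts in one: every constraint in force before the step still holds, and no
    vertex becomes newly slack.\<close>
  have vert: "load w' v \<le> real b \<and> (load w' v < real b \<longrightarrow> v \<in> slack_verts w \<or> v \<notin> \<Union>(inc ` X))
      \<or> card (active w v) < b + r" for v
  proof (cases "card (active w v) < b + r \<or> v \<notin> \<Union>(inc ` X)")
    case True
    then show ?thesis using outside[of v w'] by auto
  next
    case False
    then have "load w v \<le> real b" using assms(1) by (auto simp: feasible_def)
    then consider "v \<in> tight_verts w" | "v \<in> slack_verts w"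
      using False by (force simp: tight_verts_def slack_verts_def)
    then show ?thesis
    proof cases
      case 1
      then show ?thesis using y(4) load'[of v] by (auto simp: tight_verts_def)
    next
      case 2
      then have "(b - load w v, - load y v) \<in> J" by (auto simp: J_def)
      from t(1)[OF this] show ?thesis using load'[of v] 2 by auto
    qed
  qed
  have "feasible w'"
    unfolding feasible_def
  proof (intro conjI ballI allI)
    fix x assume x: "x \<in> X"
    then have wx: "0 \<le> w x \<and> w x \<le> 1" using assms(1) by (auto simp: feasible_def)
    show "0 \<le> w' x" "w' x \<le> 1" using wx w'_N w'_eq by (cases "x \<in> ?N"; auto)+
    have "(\<Sum>z | z \<in> X \<and> c z = c x. w' z) = (\<Sum>z | z \<in> X \<and> c z = c x. w z)"
      using y(3)[of x] by (simp add: w'_def sum.distrib flip: sum_distrib_left)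
    then show "(\<Sum>z | z \<in> X \<and> c z = c x. w' z) = 1" using assms(1) x by (auto simp: feasible_def)
  next
    fix v show "load w' v \<le> real b \<or> card (active w' v) < b + r"
      using vert[of v] card_supp[of v] by linarith
  qed
  moreover have N': "fractional w' \<subseteq> ?N"
    using w'_eq by (force simp: fractional_def)
  moreover have U': "slack_verts w' \<subseteq> slack_verts w"
  proof
    fix v assume v: "v \<in> slack_verts w'"
    then show "v \<in> slack_verts w"
      using vert[of v] card_supp[of v] by (auto simp: slack_verts_def)
  qed
  moreover have "fractional w' \<noteq> ?N \<or> slack_verts w' \<noteq> slack_verts w"
  proof -
    obtain s d where sd: "(s, d) \<in> J" "s + t * d = 0" using t(2) by auto
    then consider x where "x \<in> ?N" "w' x = 0" | x where "x \<in> ?N" "w' x = 1"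
      | v where "v \<in> slack_verts w" "load w' v = b"
      by (auto simp: J_def w'_def load')
    then consider x where "x \<in> ?N" "x \<notin> fractional w'"
      | v where "v \<in> slack_verts w" "v \<notin> slack_verts w'"
      by cases (auto simp: fractional_def slack_verts_def)
    then show ?thesis by cases blast+
  qed
  moreover have "card (fractional w') + card (slack_verts w') < card ?N + card (slack_verts w)"
    if "fractional w' \<noteq> ?N \<or> slack_verts w' \<noteq> slack_verts w"
    using that N' U' finite_fractional[of w] finite_slack_verts[of w]
    by (metis add_less_le_mono add_le_less_mono card_mono psubset_card_mono psubsetI)
  ultimately show ?thesis using that by blast
qed

lemma integral_feasible:
  assumes "feasible w"
  obtains w' where "feasible w'" "fractional w' = {}"
  using assms
proof (induction "card (fractional w) + card (slack_verts w)" arbitrary: w thesis rule: less_induct)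
  case less
  then show ?case
    using rounding_step[OF less.prems(2)] by metis
qed

text \<open>Uniform weights on each class are feasible: they are at most \<open>1 / k\<close>, so at
  most \<open>b * k\<close> elements load a vertex by at most \<open>b\<close>. Once all weights are
  0 or 1, load and number of active elements agree, and either alternative in
  \<open>feasible\<close> gives fewer than \<open>b + r\<close>.\<close>

theorem bounded_degree_transversal:
  assumes "k > 0" and classes: "\<And>x. x \<in> X \<Longrightarrow> k \<le> card {y \<in> X. c y = c x}"
    and degree: "\<And>v. card {x \<in> X. v \<in> inc x} \<le> b * k"
  obtains T where "T \<subseteq> X" "\<And>x. x \<in> X \<Longrightarrow> \<exists>y\<in>T. c y = c x"
    "\<And>v. card {x \<in> T. v \<in> inc x} < b + r"
proof -
  define w where "w x = 1 / card {y \<in> X. c y = c x}" for x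
  have w_le: "0 \<le> w x \<and> w x \<le> 1 / k" if "x \<in> X" for x
    using classes[OF that] assms(1) by (auto simp: w_def intro!: divide_left_mono)
  have "feasible w"
    unfolding feasible_def
  proof (intro conjI ballI allI disjI1)
    fix x assume x: "x \<in> X"
    show "0 \<le> w x" using w_le x by simp
    have "1 / real k \<le> 1" using assms(1) by simp
    then show "w x \<le> 1" using w_le[OF x] by linarith
    have "(\<Sum>y | y \<in> X \<and> c y = c x. w y) = (\<Sum>y | y \<in> X \<and> c y = c x. w x)"
      by (intro sum.cong) (auto simp: w_def)
    then show "(\<Sum>y | y \<in> X \<and> c y = c x. w y) = 1"
      using classes[OF x] assms(1) by (simp add: w_def)
  next
    fix v
    have "load w v \<le> card {x \<in> X. v \<in> inc x} * (1 / k)"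
      unfolding load_def using w_le by (intro sum_bounded_above) auto
    also have "\<dots> \<le> real (b * k) * (1 / k)"
      using degree[of v] by (intro mult_right_mono) (auto simp only: of_nat_le_iff zero_le_divide_1_iff of_nat_0_le_iff)
    finally show "load w v \<le> b" using assms(1) by simp
  qed
  then obtain w' where w': "feasible w'" "fractional w' = {}" using integral_feasible by metis
  have int: "w' x = 0 \<or> w' x = 1" if "x \<in> X" for x
    using w' that by (force simp: feasible_def fractional_def)
  define T where "T = {x \<in> X. w' x = 1}"
  show ?thesis
  proof (rule that[of T])
    show "T \<subseteq> X" by (auto simp: T_def)
    fix x assume "x \<in> X"
    then have "(\<Sum>y | y \<in> X \<and> c y = c x. w' y) = 1" using w' by (auto simp: feasible_def)
    then obtain y where "y \<in> X" "c y = c x" "w' y \<noteq> 0"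
      by (metis (mono_tags, lifting) mem_Collect_eq sum.neutral zero_neq_one)
    then show "\<exists>y\<in>T. c y = c x" using int by (auto simp: T_def)
  next
    fix v
    have supp: "active w' v = {x \<in> T. v \<in> inc x}"
      using int by (auto simp: active_def T_def)
    have "load w' v = (\<Sum>x | x \<in> T \<and> v \<in> inc x. 1)"
      unfolding load_def using finite_X int
      by (intro sum.mono_neutral_cong_right) (auto simp: T_def)
    then have "load w' v = card {x \<in> T. v \<in> inc x}" by simp
    then show "card {x \<in> T. v \<in> inc x} < b + r"
      using w'(1) r_pos supp unfolding feasible_def by (auto dest!: spec[of _ v])
  qed
qed

end

subsection \<open>Linear forests as edge sets\<close>

definition deg :: "'a set set \<Rightarrow> 'a \<Rightarrow> nat" where
  "deg E v = card {e \<in> E. v \<in> e}"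

text \<open>The set \<open>S\<close> is a union of components. Stating this as a cut crossed by no
  edge, not as unreachability, makes it pass to subsets of \<open>E\<close> at once and lets
  witnesses be written down directly.\<close>

definition separated :: "'a set set \<Rightarrow> 'a \<Rightarrow> 'a \<Rightarrow> bool" where
  "separated E u v \<longleftrightarrow> (\<exists>S. u \<in> S \<and> v \<notin> S \<and> (\<forall>e\<in>E. e \<subseteq> S \<or> e \<inter> S = {}))"

text \<open>Separation of the endpoints says that the new edge joins two different components.\<close>

inductive linear_edges :: "'a set set \<Rightarrow> bool" where
  empty: "linear_edges {}"
| insert: "linear_edges E \<Longrightarrow> deg E u \<le> 1 \<Longrightarrow> deg E v \<le> 1 \<Longrightarrow> separated E u v \<Longrightarrow> linear_edges (insert {u, v} E)"

lemma deg_insert: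
  assumes "finite E" "e \<notin> E"
  shows "deg (insert e E) w = deg E w + (if w \<in> e then 1 else 0)"
proof -
  have "{e' \<in> insert e E. w \<in> e'} = (if w \<in> e then insert e {e' \<in> E. w \<in> e'} else {e' \<in> E. w \<in> e'})"
    by auto
  then show ?thesis using assms by (auto simp: deg_def)
qed

lemma deg_remove:
  assumes "finite E" "e \<in> E"
  shows "deg E w = deg (E - {e}) w + (if w \<in> e then 1 else 0)"
  using deg_insert[of "E - {e}" e w] assms by (simp add: insert_absorb)

lemma deg_Un_disjoint:
  assumes "finite R" "finite B" "R \<inter> B = {}"
  shows "deg (R \<union> B) w = deg R w + deg B w"
proof -
  have "{e \<in> R \<union> B. w \<in> e} = {e \<in> R. w \<in> e} \<union> {e \<in> B. w \<in> e}" by auto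
  then show ?thesis using assms unfolding deg_def
    by (simp add: card_Un_disjoint disjoint_iff)
qed

lemma deg_mono: "finite E \<Longrightarrow> E' \<subseteq> E \<Longrightarrow> deg E' w \<le> deg E w"
  unfolding deg_def by (rule card_mono) auto

lemma deg_eq_0_iff: "finite E \<Longrightarrow> deg E w = 0 \<longleftrightarrow> w \<notin> \<Union>E"
  by (auto simp: deg_def)

lemma separated_mono: "separated E u v \<Longrightarrow> E' \<subseteq> E \<Longrightarrow> separated E' u v"
  unfolding separated_def by blast

lemma separated_edge: "separated E u v \<Longrightarrow> {u, v} \<notin> E"
  unfolding separated_def by auto

lemma separated_neq: "separated E u v \<Longrightarrow> u \<noteq> v"
  unfolding separated_def by blast

lemma linear_edges_finite: "linear_edges E \<Longrightarrow> finite E"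
  by (induction rule: linear_edges.induct) auto

lemma linear_edges_card_edge: "linear_edges E \<Longrightarrow> e \<in> E \<Longrightarrow> card e = 2"
  by (induction rule: linear_edges.induct) (auto dest: separated_neq)

lemma linear_edges_subset: "linear_edges E \<Longrightarrow> E' \<subseteq> E \<Longrightarrow> linear_edges E'"
proof (induction arbitrary: E' rule: linear_edges.induct)
  case empty
  then show ?case by (simp add: linear_edges.empty)
next
  case (insert E u v)
  let ?D = "E' - {{u, v}}"
  have D: "?D \<subseteq> E" using insert.prems by auto
  have "linear_edges ?D" using insert.IH[OF D] .
  have "linear_edges (Set.insert {u, v} ?D)"
    using D \<open>linear_edges ?D\<close> insert.hyps deg_mono[OF linear_edges_finite[OF insert.hyps(1)] D] separated_mono
    by (intro linear_edges.insert) (auto intro: le_trans)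
  moreover have "E' = ?D \<or> E' = Set.insert {u, v} ?D" by auto
  ultimately show ?case using \<open>linear_edges ?D\<close> by metis
qed

text \<open>An endpoint \<open>v\<close> without edges is cut off by \<open>- {v}\<close>, so no
  cycle can be closed.\<close>

lemma linear_edges_insert_pendant:
  assumes "linear_edges E" "deg E u \<le> 1" "deg E v = 0" "u \<noteq> v"
  shows "linear_edges (insert {u, v} E)"
proof (rule linear_edges.insert)
  have "v \<notin> \<Union>E" using assms linear_edges_finite deg_eq_0_iff by metis
  then show "separated E u v" using assms(4)
    unfolding separated_def by (intro exI[of _ "- {v}"]) auto
qed (use assms in auto)

section \<open>Vertex lists of paths and the components of a linear forest\<close>

fun path_edges :: "'a list \<Rightarrow> 'a set set" where
  "path_edges (x # y # zs) = insert {x, y} (path_edges (y # zs))"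
| "path_edges _ = {}"

lemma path_edges_nth: "path_edges xs = {{xs ! i, xs ! Suc i} | i. Suc i < length xs}"
proof (induction xs rule: path_edges.induct)
  case (1 x y zs)
  have "{{(x # y # zs) ! i, (x # y # zs) ! Suc i} | i. Suc i < length (x # y # zs)} =
    insert {x, y} {{(y # zs) ! i, (y # zs) ! Suc i} | i. Suc i < length (y # zs)}" (is "?L = ?R")
  proof (intro equalityI subsetI)
    fix e assume "e \<in> ?L"
    then obtain i where "e = {(x # y # zs) ! i, (x # y # zs) ! Suc i}" "Suc i < length (x # y # zs)" by auto
    then show "e \<in> ?R" by (cases i) auto
  next
    fix e assume "e \<in> ?R"
    then consider "e = {x, y}" | i where "e = {(y # zs) ! i, (y # zs) ! Suc i}" "Suc i < length (y # zs)" by auto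
    then show "e \<in> ?L"
    proof cases
      case 1
      then show ?thesis by (auto intro!: exI[of _ 0])
    next
      case (2 i)
      then show ?thesis by (auto intro!: exI[of _ "Suc i"])
    qed
  qed
  with 1 show ?case by simp
qed auto

lemma path_edges_append:
  "xs \<noteq> [] \<Longrightarrow> ys \<noteq> [] \<Longrightarrow>
    path_edges (xs @ ys) = insert {last xs, hd ys} (path_edges xs \<union> path_edges ys)"
proof (induction xs rule: path_edges.induct)
  case ("2_2" x)
  then show ?case by (cases ys) auto
qed auto

lemma path_edges_rev: "path_edges (rev xs) = path_edges xs"
proof (induction xs rule: path_edges.induct)
  case (1 x y zs)
  have "path_edges (rev (y # zs) @ [x]) = insert {y, x} (path_edges (rev (y # zs)))"
    by (subst path_edges_append) auto
  with 1 show ?case by (simp add: insert_commute)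
qed auto

lemma path_edges_subset: "e \<in> path_edges xs \<Longrightarrow> e \<subseteq> set xs \<and> e \<noteq> {}"
  by (induction xs rule: path_edges.induct) auto

text \<open>Connectedness of a path in the language of cuts.\<close>

lemma path_edges_closed:
  "\<forall>e\<in>path_edges xs. e \<subseteq> S \<or> e \<inter> S = {} \<Longrightarrow> set xs \<subseteq> S \<or> set xs \<inter> S = {}"
  by (induction xs rule: path_edges.induct) auto

lemma path_end_if_deg_le_1:
  assumes "finite E" "path_edges xs \<subseteq> E" "distinct xs" "u \<in> set xs" "deg E u \<le> 1"
  shows "u = hd xs \<or> u = last xs"
proof (rule ccontr)
  assume neg: "\<not> ?thesis"
  obtain as bs where xs: "xs = as @ u # bs" using assms(4) by (auto simp: in_set_conv_decomp)
  then have ne: "as \<noteq> []" "bs \<noteq> []" using neg by auto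
  then have "{last as, u} \<in> path_edges xs" "{u, hd bs} \<in> path_edges xs"
    unfolding xs by (cases bs; simp add: path_edges_append)+
  then have sub: "{{last as, u}, {u, hd bs}} \<subseteq> {e \<in> E. u \<in> e}" using assms(2) by auto
  have "last as \<in> set as" "hd bs \<in> set bs" using ne by auto
  then have "{last as, u} \<noteq> {u, hd bs}"
    using assms(3) unfolding xs by (auto simp: doubleton_eq_iff)
  then have "2 = card {{last as, u}, {u, hd bs}}" by simp
  also have "\<dots> \<le> deg E u" unfolding deg_def using sub assms(1) by (intro card_mono) auto
  finally show False using assms(5) by simp
qed

text \<open>The lists cover the whole type, with singletons for untouched elements, so that
  inserting an edge always joins two existing lists.\<close>

definition path_cover :: "'a list set \<Rightarrow> 'a set set \<Rightarrow> bool" where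
  "path_cover P E \<longleftrightarrow> (\<forall>xs\<in>P. xs \<noteq> [] \<and> distinct xs) \<and> (\<forall>x. \<exists>xs\<in>P. x \<in> set xs) \<and>
     (\<forall>xs\<in>P. \<forall>ys\<in>P. xs \<noteq> ys \<longrightarrow> set xs \<inter> set ys = {}) \<and> E = \<Union>(path_edges ` P)"

lemma path_cover_closed:
  assumes "path_cover P E" "xs \<in> P" "e \<in> E"
  shows "e \<in> path_edges xs \<or> e \<inter> set xs = {}"
proof -
  obtain ys where ys: "ys \<in> P" "e \<in> path_edges ys" using assms by (auto simp: path_cover_def)
  then have "ys = xs \<or> set ys \<inter> set xs = {}" using assms unfolding path_cover_def by blast
  then show ?thesis using ys path_edges_subset by blast
qed

lemma path_cover_separated:
  assumes "path_cover P E" "xs \<in> P" "ys \<in> P" "xs \<noteq> ys" "u \<in> set xs" "v \<in> set ys"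
  shows "separated E u v"
proof -
  have "set xs \<inter> set ys = {}" using assms unfolding path_cover_def by blast
  then show ?thesis unfolding separated_def
    using assms path_cover_closed[OF assms(1,2)] path_edges_subset
    by (intro exI[of _ "set xs"]) blast
qed

lemma linear_edges_path_cover: "linear_edges E \<Longrightarrow> \<exists>P. path_cover P E"
proof (induction rule: linear_edges.induct)
  case empty
  show ?case by (intro exI[of _ "range (\<lambda>x. [x])"]) (auto simp: path_cover_def)
next
  case (insert E u v)
  then obtain P where P: "path_cover P E" by auto
  then obtain xs ys where xy: "xs \<in> P" "u \<in> set xs" "ys \<in> P" "v \<in> set ys"
    unfolding path_cover_def by meson
  have sub: "path_edges xs \<subseteq> E" "path_edges ys \<subseteq> E" using P xy by (auto simp: path_cover_def)
  have dist: "xs \<noteq> []" "ys \<noteq> []" "distinct xs" "distinct ys" using P xy by (auto simp: path_cover_def)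
  obtain S where S: "u \<in> S" "v \<notin> S" "\<forall>e\<in>E. e \<subseteq> S \<or> e \<inter> S = {}"
    using insert.hyps unfolding separated_def by auto
  \<comment> \<open>A common list would have to cross the cut \<open>S\<close>.\<close>
  have neq: "xs \<noteq> ys" using path_edges_closed[of xs S] S sub xy by blast
  then have disj: "set xs \<inter> set ys = {}" using P xy unfolding path_cover_def by blast
  note fin = linear_edges_finite[OF insert.hyps(1)]
  \<comment> \<open>The degree bounds make \<open>u\<close> and \<open>v\<close> ends of their
    lists; reversal puts them where the lists are glued.\<close>
  define xs' where "xs' = (if u = last xs then xs else rev xs)"
  define ys' where "ys' = (if v = hd ys then ys else rev ys)"
  have xs': "set xs' = set xs" "distinct xs'" "xs' \<noteq> []" "last xs' = u" "path_edges xs' = path_edges xs"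
    using path_end_if_deg_le_1[OF fin sub(1)] dist xy insert.hyps
    by (auto simp: xs'_def path_edges_rev last_rev)
  have ys': "set ys' = set ys" "distinct ys'" "ys' \<noteq> []" "hd ys' = v" "path_edges ys' = path_edges ys"
    using path_end_if_deg_le_1[OF fin sub(2)] dist xy insert.hyps
    by (auto simp: ys'_def path_edges_rev hd_rev)
  define Q where "Q = Set.insert (xs' @ ys') (P - {xs, ys})"
  have "path_cover Q (Set.insert {u, v} E)"
    unfolding path_cover_def
  proof (intro conjI ballI allI impI)
    fix l assume "l \<in> Q"
    then show "l \<noteq> []" "distinct l" using P xs' ys' disj by (auto simp: Q_def path_cover_def)
  next
    fix x
    obtain l where "l \<in> P" "x \<in> set l" using P unfolding path_cover_def by meson
    then show "\<exists>l\<in>Q. x \<in> set l" using xs' ys' by (cases "l = xs \<or> l = ys") (auto simp: Q_def)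
  next
    fix l m assume lm: "l \<in> Q" "m \<in> Q" "l \<noteq> m"
    have P': "set l \<inter> set m = {}" if "l \<in> P" "m \<in> P" "l \<noteq> m" for l m
      using P that unfolding path_cover_def by blast
    show "set l \<inter> set m = {}"
      using lm P'[of l m] P'[of l xs] P'[of l ys] P'[of xs m] P'[of ys m] xy xs' ys'
      unfolding Q_def by auto
  next
    have "E = path_edges xs \<union> path_edges ys \<union> \<Union>(path_edges ` (P - {xs, ys}))"
      using P xy unfolding path_cover_def by auto
    then show "Set.insert {u, v} E = \<Union>(path_edges ` Q)"
      using xs' ys' by (simp add: Q_def path_edges_append)
  qed
  then show ?case by blast
qed

text \<open>A path has only two ends, so three distinct vertices of degree at most 1 cannot share a
  component.\<close>

lemma linear_edges_leaf_unreachable: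
  assumes "linear_edges E" "deg E u \<le> 1" "deg E v \<le> 1" "deg E w \<le> 1" "u \<noteq> v" "v \<noteq> w" "u \<noteq> w"
    "\<not> separated E u v"
  shows "separated E v w"
proof (rule ccontr)
  assume neg: "\<not> separated E v w"
  obtain P where P: "path_cover P E" using linear_edges_path_cover assms by blast
  then obtain xs ys zs where xyz: "xs \<in> P" "u \<in> set xs" "ys \<in> P" "v \<in> set ys" "zs \<in> P" "w \<in> set zs"
    unfolding path_cover_def by meson
  then have eq: "xs = ys" "ys = zs" using path_cover_separated[OF P] assms neg by blast+
  have "path_edges xs \<subseteq> E" "distinct xs" using P xyz by (auto simp: path_cover_def)
  then show False
    using path_end_if_deg_le_1[OF linear_edges_finite[OF assms(1)], of xs] assms xyz unfolding eq by metis
qed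

lemma linear_forest_if_linear_edges:
  assumes "linear_edges E" "\<Union>E \<subseteq> V"
  shows "linear_forest \<lparr>verts = V, edges = E\<rparr>"
proof -
  let ?F = "\<lparr>verts = V, edges = E\<rparr>"
  obtain P where P: "path_cover P E" using linear_edges_path_cover assms by blast
  have sym: "sym ((adjacent_rel ?F)\<^sup>*)"
    by (intro sym_rtrancl) (auto simp: sym_def adjacent_rel_def insert_commute)
  have "is_path (induced_subgraph ?F {v \<in> V. (u, v) \<in> (adjacent_rel ?F)\<^sup>*})" if u: "u \<in> V" for u
  proof -
    let ?S = "{v. (u, v) \<in> (adjacent_rel ?F)\<^sup>*}"
    obtain xs where xs: "xs \<in> P" "u \<in> set xs" using P unfolding path_cover_def by meson
    then have xs': "distinct xs" "xs \<noteq> []" "path_edges xs \<subseteq> E" using P by (auto simp: path_cover_def)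
    have "set xs \<subseteq> V" using path_edges_closed[of xs V] xs xs' assms(2) u by blast
    moreover have "?S \<subseteq> set xs"
    proof
      fix v assume "v \<in> ?S"
      then have "(u, v) \<in> (adjacent_rel ?F)\<^sup>*" by simp
      then show "v \<in> set xs"
      proof induction
        case (step y z)
        then have "{y, z} \<in> E" by (simp add: adjacent_rel_def)
        then show ?case using path_cover_closed[OF P xs(1)] step path_edges_subset by blast
      qed (rule xs)
    qed
    moreover have "set xs \<subseteq> ?S"
    proof -
      have "e \<subseteq> ?S \<or> e \<inter> ?S = {}" if e: "e \<in> E" for e
      proof -
        obtain a b where ab: "e = {a, b}" using linear_edges_card_edge[OF assms(1) e] by (auto simp: card_2_iff)
        then have "(a, b) \<in> adjacent_rel ?F" "(b, a) \<in> adjacent_rel ?F"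
          using e by (auto simp: adjacent_rel_def insert_commute)
        then show ?thesis unfolding ab by (auto intro: rtrancl_into_rtrancl)
      qed
      then show ?thesis using path_edges_closed[of xs ?S] xs xs' by blast
    qed
    ultimately have S: "{v \<in> V. (u, v) \<in> (adjacent_rel ?F)\<^sup>*} = set xs" by auto
    have "{e \<in> E. e \<subseteq> set xs} = path_edges xs"
    proof (intro equalityI subsetI)
      fix e assume e: "e \<in> {e \<in> E. e \<subseteq> set xs}"
      then have "card e = 2" using linear_edges_card_edge[OF assms(1)] by auto
      then have "e \<noteq> {}" by auto
      then have "e \<inter> set xs \<noteq> {}" using e by auto
      then show "e \<in> path_edges xs" using path_cover_closed[OF P xs(1)] e by blast
    next
      fix e assume "e \<in> path_edges xs"
      then show "e \<in> {e \<in> E. e \<subseteq> set xs}" using path_edges_subset xs' by blast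
    qed
    then show ?thesis unfolding S is_path_def induced_subgraph_def
      using xs' by (intro exI[of _ xs]) (simp add: path_edges_nth)
  qed
  moreover have "simple_graph ?F"
    using assms linear_edges_card_edge by (auto simp: simple_graph_def)
  ultimately show ?thesis by (auto simp: linear_forest_def components_def)
qed

lemma ex_edge_if_deg_pos:
  assumes "linear_edges E" "deg E u > 0"
  obtains x where "{u, x} \<in> E" "x \<noteq> u"
proof -
  obtain e where e: "e \<in> E" "u \<in> e" using assms(2) by (auto simp: deg_def card_gt_0_iff)
  then obtain a b where "e = {a, b}" "a \<noteq> b" using linear_edges_card_edge[OF assms(1)] by (metis card_2_iff)
  then show ?thesis using e that by (auto simp: insert_commute)
qed

subsection \<open>Linear arboricity of subcubic graphs\<close>

text \<open>The colours at the uncoloured edge \<open>uv\<close> exclude each other: \<open>u\<close> has two edges in \<open>R\<close>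
  and \<open>v\<close> has two in \<open>B\<close>. Colouring \<open>uv\<close> with \<open>R\<close> and uncolouring an \<open>R\<close>-edge \<open>ux\<close> moves the
  problem to \<open>ux\<close> with the colours swapped. The set \<open>S\<close> of vertices left behind shows that this
  walk never meets itself.\<close>

lemma subcubic_exchange:
  assumes "linear_edges R" "linear_edges B" "R \<inter> B = {}" "{u, v} \<notin> R \<union> B" "u \<noteq> v" "T = insert {u, v} (R \<union> B)"
    "\<And>w. deg T w \<le> 3" "finite (\<Union>T)" "deg R u = 2" "deg R v = 0" "deg B u = 0" "deg B v = 2"
    "v \<in> S" "u \<notin> S"
    "\<And>s. s \<in> S - {v} \<Longrightarrow> deg R s = 2 \<and> (\<forall>e\<in>B. s \<in> e \<longrightarrow> e \<subseteq> S) \<or>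
      deg B s = 2 \<and> (\<forall>e\<in>R. s \<in> e \<longrightarrow> e \<subseteq> S)"
  shows "\<exists>R' B'. linear_edges R' \<and> linear_edges B' \<and> R' \<inter> B' = {} \<and> R' \<union> B' = T"
  using assms
proof (induction "card (\<Union>T - S)" arbitrary: R B u v S rule: less_induct)
  case less
  note p = less.prems
  have fin: "finite R" "finite B" using p linear_edges_finite by auto
  obtain x where x: "{u, x} \<in> R" "x \<noteq> u" using ex_edge_if_deg_pos[OF p(1), of u] p(9) by auto
  have xv: "x \<noteq> v" using x p(10) deg_eq_0_iff[OF fin(1)] by blast
  let ?D = "R - {{u, x}}" and ?R = "insert {u, v} (R - {{u, x}})"
  have R0: "linear_edges ?D" "finite ?D" using linear_edges_subset[OF p(1), of ?D] fin by auto
  have degR0: "deg R w = deg ?D w + (if w \<in> {u, x} then 1 else 0)" for w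
    by (rule deg_remove[OF fin(1) x(1)])
  have degR1: "deg ?R w = deg ?D w + (if w \<in> {u, v} then 1 else 0)" for w
    by (rule deg_insert) (use fin p in auto)
  have degT: "deg T w = deg R w + deg B w + (if w \<in> {u, v} then 1 else 0)" for w
    using deg_insert[of "R \<union> B" "{u, v}" w] deg_Un_disjoint[OF fin p(3), of w] p(4,6) fin by simp
  \<comment> \<open>Without \<open>ux\<close>, vertex \<open>u\<close> keeps one edge of this colour
    and \<open>v\<close> has none, so \<open>uv\<close> is pendant.\<close>
  have R: "linear_edges ?R"
    using R0 degR0[of u] degR0[of v] p(5,9,10) by (intro linear_edges_insert_pendant) auto
  have ux_B: "{u, x} \<notin> B" using x p(3) by auto
  have uvx: "{u, x} \<noteq> {u, v}" using xv by (auto simp: doubleton_eq_iff)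
  show ?case
  proof (cases "deg B x \<le> 1")
    case True
    have "linear_edges (insert {x, u} B)"
      using True p x by (intro linear_edges_insert_pendant) auto
    then have "linear_edges (insert {u, x} B)" by (simp add: insert_commute)
    moreover have "?R \<inter> insert {u, x} B = {}" using p(3,4) uvx by auto
    moreover have "?R \<union> insert {u, x} B = T" using p(6) x by auto
    ultimately show ?thesis using R by blast
  next
    case False
    then have degx: "deg B x = 2" "deg R x = 1" "deg ?D x = 0"
      using degT[of x] p(7)[of x] degR0[of x] xv x by auto
    \<comment> \<open>The invariant on \<open>S\<close> would give \<open>x\<close> either two
      \<open>R\<close>-edges, but it has one, or only \<open>R\<close>-edges inside
      \<open>S\<close>, but \<open>ux\<close> leaves \<open>S\<close>.\<close>
    have xS: "x \<notin> S" using p(14) p(15)[of x] x xv degx by auto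
    show ?thesis
    \<comment> \<open>The same configuration at the edge \<open>xu\<close>, with the colours
      exchanged and \<open>u\<close> added to the vertices left behind.\<close>
    proof (rule less.hyps[of "insert u S" B ?R x u])
      have "u \<in> \<Union>T" using p(6) by auto
      then show "card (\<Union>T - insert u S) < card (\<Union>T - S)"
        using p(8,14) by (intro psubset_card_mono) auto
      show "B \<inter> ?R = {}" "{x, u} \<notin> B \<union> ?R" using p(3,4) ux_B uvx by (auto simp: insert_commute)
      show "T = insert {x, u} (B \<union> ?R)" using p(6) x by (auto simp: insert_commute)
      show "deg B x = 2" "deg B u = 0" "deg ?R x = 0" "deg ?R u = 2"
        using degx degR1[of x] degR1[of u] degR0[of u] p x xv by auto
      show "u \<in> insert u S" "x \<notin> insert u S" using x xS by auto
      fix s assume s: "s \<in> insert u S - {u}"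
      show "deg B s = 2 \<and> (\<forall>e\<in>?R. s \<in> e \<longrightarrow> e \<subseteq> insert u S) \<or>
        deg ?R s = 2 \<and> (\<forall>e\<in>B. s \<in> e \<longrightarrow> e \<subseteq> insert u S)"
      proof (cases "s = v")
        case True
        \<comment> \<open>The only recoloured edge at \<open>v\<close> is \<open>uv\<close>, which
          now lies inside the enlarged set.\<close>
        have "\<forall>e\<in>R. v \<notin> e" using p(10) deg_eq_0_iff[OF fin(1)] by blast
        then show ?thesis using True p(12,13) by auto
      next
        case False
        then have "s \<in> S - {v}" "s \<noteq> u" "s \<noteq> x" using s xS by auto
        then show ?thesis using p(15)[of s] degR0[of s] degR1[of s] False by auto
      qed
    qed (use R p x in auto)
  qed
qed

text \<open>Edges are inserted one at a time. Each end of a new edge has at most two coloured edges,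
  so a colour used twice there leaves the other one free. Two obstructions remain: opposite colours
  saturated at the two ends, resolved by \<open>subcubic_exchange\<close>, or all degrees at most 1
  while both colours would close a cycle.\<close>

theorem subcubic_linear_arboricity:
  assumes "finite E" "\<And>e. e \<in> E \<Longrightarrow> card e = 2" "\<And>v. deg E v \<le> 3"
  obtains R B where "linear_edges R" "linear_edges B" "R \<inter> B = {}" "R \<union> B = E"
proof -
  have "\<exists>R B. linear_edges R \<and> linear_edges B \<and> R \<inter> B = {} \<and> R \<union> B = E"
    using assms
  proof (induction E rule: finite_induct)
    case empty
    then show ?case using linear_edges.empty by blast
  next
    case (insert e E)
    note deg3 = insert.prems(2)
    have "deg E w \<le> 3" for w
      using deg_mono[of "insert e E" E w] insert by (meson finite.insertI le_trans subset_insertI)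
    then obtain R B where RB: "linear_edges R" "linear_edges B" "R \<inter> B = {}" "R \<union> B = E" using insert by auto
    obtain u v where uv: "e = {u, v}" "u \<noteq> v" using insert.prems(1) by (metis card_2_iff insertI1)
    have fin: "finite R" "finite B" using RB linear_edges_finite by auto
    have degT: "deg (insert e E) w = deg R w + deg B w + (if w \<in> {u, v} then 1 else 0)" for w
      using deg_insert[OF insert.hyps, of w] deg_Un_disjoint[OF fin RB(3), of w] RB(4) uv by simp
    have colour_R: ?case if "linear_edges (insert {u, v} R)"
      using RB uv insert.hyps that by (intro exI[of _ "insert {u, v} R"] exI[of _ B]) auto
    have colour_B: ?case if "linear_edges (insert {u, v} B)"
      using RB uv insert.hyps that by (intro exI[of _ R] exI[of _ "insert {u, v} B"]) auto
    have exchange: "\<exists>R B. linear_edges R \<and> linear_edges B \<and> R \<inter> B = {} \<and> R \<union> B = insert e E"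
      if "linear_edges R'" "linear_edges B'" "R' \<inter> B' = {}" "R' \<union> B' = E" "e = {a, b}" "a \<noteq> b"
        "deg R' a = 2" "deg R' b = 0" "deg B' a = 0" "deg B' b = 2" for R' B' a b
    proof (rule subcubic_exchange[where S = "{b}" and u = a and v = b and R = R' and B = B'])
      show "finite (\<Union>(insert e E))"
        using insert by (metis finite_Union card.infinite finite.insertI zero_neq_numeral)
    qed (use that insert deg3 in auto)
    have degs: "deg R u + deg B u \<le> 2" "deg R v + deg B v \<le> 2"
      using degT[of u] degT[of v] deg3[of u] deg3[of v] by auto
    have pendant: "linear_edges (insert {u, v} D)" if "linear_edges D" "deg D u = 0 \<and> deg D v \<le> 1 \<or> deg D v = 0 \<and> deg D u \<le> 1" for D
      using that uv linear_edges_insert_pendant[of D u v] linear_edges_insert_pendant[of D v u] by (auto simp: insert_commute)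
    consider "deg R u \<ge> 2" | "deg B u \<ge> 2" | "deg R v \<ge> 2" | "deg B v \<ge> 2"
      | "deg R u \<le> 1" "deg R v \<le> 1" "deg B u \<le> 1" "deg B v \<le> 1" by linarith
    then show ?case
    proof cases
      case 1
      show ?thesis
      proof (cases "deg B v \<le> 1")
        case True
        then show ?thesis using colour_B pendant[OF RB(2)] 1 degs by auto
      next
        case False
        show ?thesis by (rule exchange[of R B u v]) (use 1 False degs uv RB in auto)
      qed
    next
      case 2
      show ?thesis
      proof (cases "deg R v \<le> 1")
        case True
        then show ?thesis using colour_R pendant[OF RB(1)] 2 degs by auto
      next
        case False
        show ?thesis by (rule exchange[of B R u v]) (use 2 False degs uv RB in auto)
      qed
    next
      case 3
      show ?thesis
      proof (cases "deg B u \<le> 1")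
        case True
        then show ?thesis using colour_B pendant[OF RB(2)] 3 degs by auto
      next
        case False
        show ?thesis by (rule exchange[of R B v u]) (use 3 False degs uv RB in auto)
      qed
    next
      case 4
      show ?thesis
      proof (cases "deg R u \<le> 1")
        case True
        then show ?thesis using colour_R pendant[OF RB(1)] 4 degs by auto
      next
        case False
        show ?thesis by (rule exchange[of B R v u]) (use 4 False degs uv RB in auto)
      qed
    next
      case 5
      show ?thesis
      proof (cases "deg R v = 0 \<or> separated R u v \<or> separated B u v")
        case True
        then show ?thesis
          using colour_R colour_B pendant[OF RB(1)] linear_edges.insert[OF RB(1)] linear_edges.insert[OF RB(2)] 5 by blast
      next
        case False
        \<comment> \<open>Both colours join \<open>u\<close> to \<open>v\<close>; exchange \<open>uv\<close> with the edge \<open>vx\<close> of the \<open>R\<close>-path.\<close>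
        then have "deg R v > 0" by simp
        then obtain x where x: "{v, x} \<in> R" "x \<noteq> v" by (rule ex_edge_if_deg_pos[OF RB(1)])
        have xu: "x \<noteq> u" using x uv RB insert.hyps by (auto simp: insert_commute)
        have "\<not> separated R v x" using x(1) separated_edge[of R v x] by auto
        \<comment> \<open>\<open>u\<close> and \<open>v\<close> are already both ends of that
          \<open>R\<close>-path, so \<open>x\<close> is an inner vertex and has at most one edge in
          \<open>B\<close>.\<close>
        then have "\<not> deg R x \<le> 1"
          using linear_edges_leaf_unreachable[OF RB(1), of u v x] 5 False uv x xu by blast
        then have degBx: "deg B x \<le> 1"
          using degT[of x] deg3[of x] by (auto split: if_splits)
        \<comment> \<open>The \<open>B\<close>-path between \<open>u\<close> and \<open>v\<close>
          has no third end, so \<open>x\<close> lies in another \<open>B\<close>-component.\<close>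
        have "separated B v x"
          using linear_edges_leaf_unreachable[OF RB(2), of u v x] 5 False uv x xu degBx by blast
        then have B: "linear_edges (insert {v, x} B)" using linear_edges.insert[OF RB(2)] 5 degBx by blast
        have "deg (R - {{v, x}}) v = 0" "deg (R - {{v, x}}) u \<le> 1"
          using deg_remove[OF fin(1) x(1), of v] deg_remove[OF fin(1) x(1), of u] 5 by auto
        then have R: "linear_edges (insert {u, v} (R - {{v, x}}))"
          using uv linear_edges_subset[OF RB(1)] by (intro linear_edges_insert_pendant) auto
        have "insert {u, v} (R - {{v, x}}) \<inter> insert {v, x} B = {}"
          using RB uv insert.hyps xu by (auto simp: doubleton_eq_iff)
        moreover have "insert {u, v} (R - {{v, x}}) \<union> insert {v, x} B = insert e E"
          using RB uv x by auto
        ultimately show ?thesis using R B by blast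
      qed
    qed
  qed
  then show ?thesis using that by blast
qed

subsection \<open>Two-factorization\<close>

text \<open>Choosing one end of every edge as its tail is a transversal with classes of size 2; a
  vertex lies in \<open>2 * k\<close> incidences, so \<open>b = k\<close> and \<open>r = 1\<close>
  give out-degree at most \<open>k\<close>.\<close>

lemma balanced_orientation:
  assumes "finite V" "\<And>e. e \<in> E \<Longrightarrow> e \<subseteq> V \<and> card e = 2" "\<And>v. v \<in> V \<Longrightarrow> deg E v = 2 * k"
  obtains A where "A \<subseteq> V \<times> V" "bij_betw (\<lambda>(u, v). {u, v}) A E"
    "\<And>v. v \<in> V \<Longrightarrow> card {w. (v, w) \<in> A} = k" "\<And>v. v \<in> V \<Longrightarrow> card {w. (w, v) \<in> A} = k"
proof -
  have finE: "finite E" using assms(1,2) by (intro finite_subset[of E "Pow V"]) auto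
  define X where "X = {(e, v). e \<in> E \<and> v \<in> e}"
  have X_sub: "X \<subseteq> E \<times> V" using assms(2) by (auto simp: X_def)
  interpret partitioned_hypergraph X fst "\<lambda>x. {snd x}" 1 k
    by standard (use X_sub assms(1) finE in \<open>auto intro: finite_subset\<close>)
  have classes: "2 \<le> card {y \<in> X. fst y = fst x}" if "x \<in> X" for x
  proof -
    have e: "fst x \<in> E" using that by (auto simp: X_def)
    have "{y \<in> X. fst y = fst x} = Pair (fst x) ` fst x" using e by (auto simp: X_def)
    then show ?thesis using assms(2)[OF e] by (simp add: card_image inj_on_def)
  qed
  have degree: "card {x \<in> X. v \<in> {snd x}} \<le> k * 2" for v
  proof (cases "v \<in> V")
    case True
    have "{x \<in> X. v \<in> {snd x}} = (\<lambda>e. (e, v)) ` {e \<in> E. v \<in> e}" by (auto simp: X_def)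
    then show ?thesis using assms(3)[OF True] by (simp add: card_image inj_on_def deg_def)
  next
    case False
    then have empty: "{x \<in> X. v \<in> {snd x}} = {}" using X_sub by auto
    show ?thesis unfolding empty by simp
  qed
  obtain T where T: "T \<subseteq> X" "\<And>x. x \<in> X \<Longrightarrow> \<exists>y\<in>T. fst y = fst x"
    "\<And>v. card {x \<in> T. v \<in> {snd x}} < k + 1"
    by (rule bounded_degree_transversal[of 2]) (use classes degree in auto)
  have "\<exists>v. (e, v) \<in> T" if e: "e \<in> E" for e
  proof -
    have "e \<noteq> {}" using assms(2)[OF e] by auto
    then obtain v where "(e, v) \<in> X" using e by (auto simp: X_def)
    then show ?thesis using T(2) by fastforce
  qed
  then obtain t where t: "\<And>e. e \<in> E \<Longrightarrow> (e, t e) \<in> T" by metis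
  have te: "t e \<in> e" if "e \<in> E" for e using t[OF that] T(1) by (auto simp: X_def)
  have out_le: "card {e \<in> E. t e = v} \<le> k" for v
  proof -
    have "finite T" using T(1) finite_X finite_subset by blast
    then have "card ((\<lambda>e. (e, v)) ` {e \<in> E. t e = v}) \<le> card {x \<in> T. v \<in> {snd x}}"
      using t by (intro card_mono) auto
    then show ?thesis using T(3)[of v] by (simp add: card_image inj_on_def)
  qed
  have "card E * 2 = (\<Sum>e\<in>E. card e)" using assms(2) by simp
  also have "\<dots> = (\<Sum>e\<in>E. \<Sum>v | v \<in> V \<and> v \<in> e. 1)"
  proof (rule sum.cong[OF refl])
    fix e assume "e \<in> E"
    then have "{v. v \<in> V \<and> v \<in> e} = e" using assms(2) by auto
    then show "card e = (\<Sum>v | v \<in> V \<and> v \<in> e. 1)" by simp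
  qed
  also have "\<dots> = (\<Sum>v\<in>V. deg E v)"
    using sum.swap_restrict[OF finE assms(1), of "\<lambda>_ _. 1 :: nat" "\<lambda>e v. v \<in> e"] by (simp add: deg_def)
  also have "\<dots> = card V * (2 * k)" using assms(3) by simp
  finally have card_E: "card E = k * card V" by simp
  have "t ` E \<subseteq> V" using te assms(2) by blast
  then have "(\<Sum>v\<in>V. card {e \<in> E. t e = v}) = card E"
    using sum.group[OF finE assms(1), of t "\<lambda>_. 1 :: nat"] by simp
  then have "(\<Sum>v\<in>V. card {e \<in> E. t e = v}) = (\<Sum>v\<in>V. k)" using card_E by simp
  \<comment> \<open>Upper bounds \<open>k\<close> whose total is \<open>k * card V\<close> must all
    be attained.\<close>
  then have out: "card {e \<in> E. t e = v} = k" if "v \<in> V" for v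
    using sum_mono_inv[of "\<lambda>v. card {e \<in> E. t e = v}" V "\<lambda>_. k" v] out_le that assms(1) by auto
  have inn: "card {e \<in> E. v \<in> e \<and> t e \<noteq> v} = k" if "v \<in> V" for v
  proof -
    have "{e \<in> E. v \<in> e} = {e \<in> E. t e = v} \<union> {e \<in> E. v \<in> e \<and> t e \<noteq> v}" using te by auto
    then have "deg E v = card {e \<in> E. t e = v} + card {e \<in> E. v \<in> e \<and> t e \<noteq> v}"
      unfolding deg_def using finE by (subst card_Un_disjoint[symmetric]) auto
    then show ?thesis using out assms(3) that by simp
  qed
  have edge: "\<exists>w. e = {v, w} \<and> w \<noteq> v" if ev: "e \<in> E" "v \<in> e" for e v
  proof -
    obtain a b where "e = {a, b}" "a \<noteq> b" using assms(2)[OF ev(1)] by (metis card_2_iff)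
    then show ?thesis using ev(2) by (auto simp: insert_commute)
  qed
  define A where "A = {(u, v). {u, v} \<in> E \<and> u \<noteq> v \<and> t {u, v} = u}"
  show ?thesis
  proof (rule that[of A])
    show "A \<subseteq> V \<times> V" using assms(2) by (auto simp: A_def)
    show "bij_betw (\<lambda>(u, v). {u, v}) A E"
    proof (rule bij_betwI')
      fix x y assume xy: "x \<in> A" "y \<in> A"
      have "x = y" if eq: "{fst x, snd x} = {fst y, snd y}"
      proof -
        have "fst x = fst y" using xy arg_cong[OF eq, of t] by (simp add: A_def case_prod_unfold)
        then show ?thesis using eq by (auto simp: doubleton_eq_iff prod_eq_iff)
      qed
      then show "((\<lambda>(u, v). {u, v}) x = (\<lambda>(u, v). {u, v}) y) = (x = y)"
        unfolding case_prod_unfold by blast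
    next
      fix e assume e: "e \<in> E"
      obtain w where "{t e, w} = e" "w \<noteq> t e" using edge[OF e te[OF e]] by metis
      then have "(t e, w) \<in> A" "e = (\<lambda>(u, v). {u, v}) (t e, w)" using e by (auto simp: A_def)
      then show "\<exists>x\<in>A. e = (\<lambda>(u, v). {u, v}) x" by blast
    qed (auto simp: A_def)
    fix v assume v: "v \<in> V"
    have "inj_on (\<lambda>w. {v, w}) Z" for Z by (auto simp: inj_on_def doubleton_eq_iff)
    then have card: "card Z = card ((\<lambda>w. {v, w}) ` Z)" for Z by (simp add: card_image)
    have "(\<lambda>w. {v, w}) ` {w. (v, w) \<in> A} = {e \<in> E. t e = v}"
      using edge te by (force simp: A_def)
    then show "card {w. (v, w) \<in> A} = k" using card[of "{w. (v, w) \<in> A}"] out[OF v] by simp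
    have "(\<lambda>w. {v, w}) ` {w. (w, v) \<in> A} = {e \<in> E. v \<in> e \<and> t e \<noteq> v}"
    proof (intro equalityI subsetI)
      fix e assume e: "e \<in> {e \<in> E. v \<in> e \<and> t e \<noteq> v}"
      then obtain w where w: "e = {v, w}" "w \<noteq> v" using edge by auto
      then have "t e = w" using te e by auto
      then show "e \<in> (\<lambda>w. {v, w}) ` {w. (w, v) \<in> A}" using w e by (auto simp: A_def insert_commute)
    qed (auto simp: A_def insert_commute)
    then show "card {w. (w, v) \<in> A} = k" using card[of "{w. (w, v) \<in> A}"] inn[OF v] by simp
  qed
qed

text \<open>A permutation inside \<open>A\<close> is a perfect matching between tails and heads.
  Rounding with \<open>b = r = 1\<close> selects an arc at every tail and at most one at every head;
  removing the resulting permutation lowers all degrees by one.\<close>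

lemma permutation_decomposition:
  assumes "finite V" "A \<subseteq> V \<times> V" "\<And>v. v \<in> V \<Longrightarrow> card {w. (v, w) \<in> A} = k"
    "\<And>v. v \<in> V \<Longrightarrow> card {w. (w, v) \<in> A} = k"
  shows "\<exists>f. (\<forall>i<k. f i permutes V \<and> (\<forall>v\<in>V. (v, f i v) \<in> A)) \<and>
    (\<forall>v\<in>V. inj_on (\<lambda>i. f i v) {..<k})"
  using assms(2-)
proof (induction k arbitrary: A)
  case 0
  then show ?case by auto
next
  case (Suc k)
  have fin: "finite A" "finite {w. (v, w) \<in> A}" "finite {w. (w, v) \<in> A}" for v
    by (rule finite_subset[of _ "V \<times> V"] finite_subset[of _ V]; use assms(1) Suc.prems(1) in auto)+
  interpret partitioned_hypergraph A fst "\<lambda>x. {snd x}" 1 1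
    by standard (use fin in auto)
  have classes: "Suc k \<le> card {y \<in> A. fst y = fst x}" if "x \<in> A" for x
  proof -
    have "{y \<in> A. fst y = fst x} = Pair (fst x) ` {w. (fst x, w) \<in> A}" by force
    then show ?thesis using that Suc.prems(1,2) by (auto simp: card_image inj_on_def)
  qed
  have degree: "card {x \<in> A. v \<in> {snd x}} \<le> 1 * Suc k" for v
  proof (cases "v \<in> V")
    case True
    have "{x \<in> A. v \<in> {snd x}} = (\<lambda>w. (w, v)) ` {w. (w, v) \<in> A}" by force
    then show ?thesis using Suc.prems(3)[OF True] by (simp add: card_image inj_on_def)
  next
    case False
    then have empty: "{x \<in> A. v \<in> {snd x}} = {}" using Suc.prems(1) by auto
    show ?thesis unfolding empty by simp
  qed
  obtain T where T: "T \<subseteq> A" "\<And>x. x \<in> A \<Longrightarrow> \<exists>y\<in>T. fst y = fst x"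
    "\<And>v. card {x \<in> T. v \<in> {snd x}} < 1 + 1"
    by (rule bounded_degree_transversal[of "Suc k"]) (use classes degree in auto)
  have "\<exists>w. (v, w) \<in> T" if v: "v \<in> V" for v
  proof -
    have "{w. (v, w) \<in> A} \<noteq> {}" using Suc.prems(2)[OF v] by (metis card.empty nat.distinct(1))
    then show ?thesis using T(2) by fastforce
  qed
  then obtain h where h: "\<And>v. v \<in> V \<Longrightarrow> (v, h v) \<in> T" by metis
  \<comment> \<open>\<open>permutes\<close> demands the identity outside \<open>V\<close>.\<close>
  define g where "g v = (if v \<in> V then h v else v)" for v
  have gA: "(v, g v) \<in> A" if "v \<in> V" for v using h T(1) that by (auto simp: g_def)
  have inj: "inj_on g V"
  proof (rule inj_onI, rule ccontr)
    fix u v assume uv: "u \<in> V" "v \<in> V" "g u = g v" "u \<noteq> v"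
    then have "{(u, h u), (v, h u)} \<subseteq> {x \<in> T. h u \<in> {snd x}}"
      using h[of u] h[of v] by (auto simp: g_def)
    moreover have "finite T" using T(1) fin(1) finite_subset by blast
    ultimately have "card {(u, h u), (v, h u)} \<le> card {x \<in> T. h u \<in> {snd x}}"
      by (intro card_mono) auto
    then show False using T(3)[of "h u"] uv by simp
  qed
  moreover have "g ` V \<subseteq> V" using gA Suc.prems(1) by auto
  ultimately have bij: "bij_betw g V V" using assms(1) by (simp add: bij_betw_def endo_inj_surj)
  then have g: "g permutes V" by (rule bij_imp_permutes) (simp add: g_def)
  define A' where "A' = A - (\<lambda>v. (v, g v)) ` V"
  have out: "card {w. (v, w) \<in> A'} = k" if v: "v \<in> V" for v
  proof -
    have "{w. (v, w) \<in> A'} = {w. (v, w) \<in> A} - {g v}" using v by (auto simp: A'_def)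
    then show ?thesis using gA[OF v] Suc.prems(2)[OF v] fin by simp
  qed
  have inn: "card {w. (w, v) \<in> A'} = k" if v: "v \<in> V" for v
  proof -
    obtain u where u: "u \<in> V" "g u = v" using bij v by (metis bij_betw_iff_bijections)
    have "{w. (w, v) \<in> A'} = {w. (w, v) \<in> A} - {u}"
      using u inj by (auto simp: A'_def dest: inj_onD)
    then show ?thesis using gA[OF u(1)] u(2) Suc.prems(3)[OF v] fin by simp
  qed
  have "A' \<subseteq> V \<times> V" using Suc.prems(1) by (auto simp: A'_def)
  from Suc.IH[OF this out inn] obtain f where f: "\<And>i. i < k \<Longrightarrow> f i permutes V"
    "\<And>i v. i < k \<Longrightarrow> v \<in> V \<Longrightarrow> (v, f i v) \<in> A'" "\<And>v. v \<in> V \<Longrightarrow> inj_on (\<lambda>i. f i v) {..<k}"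
    by blast
  have "f i v \<noteq> g v" if "i < k" "v \<in> V" for i v using f(2)[OF that] that by (auto simp: A'_def)
  then have "inj_on (\<lambda>i. (f(k := g)) i v) {..<Suc k}" if "v \<in> V" for v
    using f(3)[OF that] that by (force simp: inj_on_def less_Suc_eq)
  moreover have "(f(k := g)) i permutes V" "\<forall>v\<in>V. (v, (f(k := g)) i v) \<in> A" if "i < Suc k" for i
    using f g gA that by (auto simp: A'_def less_Suc_eq)
  ultimately show ?case by blast
qed

text \<open>The permutations use distinct arcs, and \<open>A\<close> has exactly
  \<open>k * card V\<close> of them, so every arc is used.\<close>

lemma two_factorization:
  assumes "finite V" "\<And>e. e \<in> E \<Longrightarrow> e \<subseteq> V \<and> card e = 2" "\<And>v. v \<in> V \<Longrightarrow> deg E v = 2 * k"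
  obtains f where "\<And>i. i < k \<Longrightarrow> f i permutes V"
    "bij_betw (\<lambda>(v, i). {v, f i v}) (V \<times> {..<k}) E"
proof -
  obtain A where A: "A \<subseteq> V \<times> V" "bij_betw (\<lambda>(u, v). {u, v}) A E"
    "\<And>v. v \<in> V \<Longrightarrow> card {w. (v, w) \<in> A} = k" "\<And>v. v \<in> V \<Longrightarrow> card {w. (w, v) \<in> A} = k"
    by (rule balanced_orientation[OF assms]) auto
  obtain f where f: "\<And>i. i < k \<Longrightarrow> f i permutes V"
    "\<And>i v. i < k \<Longrightarrow> v \<in> V \<Longrightarrow> (v, f i v) \<in> A" "\<And>v. v \<in> V \<Longrightarrow> inj_on (\<lambda>i. f i v) {..<k}"
    using permutation_decomposition[OF assms(1) A(1,3,4)] by auto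
  have "card A = card (SIGMA v:V. {w. (v, w) \<in> A})"
    by (rule arg_cong[where f = card]) (use A(1) in auto)
  also have "\<dots> = (\<Sum>v\<in>V. card {w. (v, w) \<in> A})"
    using assms(1) A(1) by (intro card_SigmaI) (auto intro!: finite_subset[of _ V])
  finally have "card A = (\<Sum>v\<in>V. card {w. (v, w) \<in> A})" .
  then have "card A = card (V \<times> {..<k})" using A(3) by (simp add: card_cartesian_product)
  moreover have inj: "inj_on (\<lambda>(v, i). (v, f i v)) (V \<times> {..<k})"
    using f(3) by (auto simp: inj_on_def)
  moreover have "(\<lambda>(v, i). (v, f i v)) ` (V \<times> {..<k}) \<subseteq> A" using f(2) by auto
  moreover have "finite A" using A(1) assms(1) finite_subset by blast
  ultimately have "bij_betw (\<lambda>(v, i). (v, f i v)) (V \<times> {..<k}) A"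
    by (simp add: bij_betw_def card_image card_subset_eq)
  from bij_betw_trans[OF this A(2)] have "bij_betw (\<lambda>(v, i). {v, f i v}) (V \<times> {..<k}) E"
    by (simp add: comp_def case_prod_unfold)
  then show ?thesis using that f(1) by blast
qed


subsection \<open>Breaking the cycles\<close>

text \<open>The third hypothesis says that \<open>A\<close> contains no complete cycle of
  \<open>f\<close>. Adding the arc from \<open>a\<close> to \<open>f a\<close> could only close a
  cycle if following \<open>f\<close> from \<open>f a\<close> through \<open>A\<close> led back to
  \<open>a\<close>.\<close>

lemma linear_edges_permutation_edges:
  assumes "inj f" "finite A" "\<And>B. B \<subseteq> A \<Longrightarrow> f ` B \<subseteq> B \<Longrightarrow> B = {}"
  shows "linear_edges ((\<lambda>v. {v, f v}) ` A)"
  using assms(2,3)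
proof (induction A rule: finite_induct)
  case empty
  then show ?case by (simp add: linear_edges.empty)
next
  case (insert a A)
  let ?E = "(\<lambda>v. {v, f v}) ` A"
  have lin_E: "linear_edges ?E" using insert by blast
  have inj: "x = y" if "f x = f y" for x y using assms(1) that by (auto dest: injD)
  \<comment> \<open>Since \<open>a\<close> is not in \<open>A\<close>, only the arc entering
    \<open>a\<close> can be present; at \<open>f a\<close>, by injectivity, only the leaving
    one.\<close>
  have "{e \<in> ?E. a \<in> e} \<subseteq> {{inv f a, a}}"
    using insert.hyps assms(1) by (auto simp: inv_f_f)
  then have deg_a: "deg ?E a \<le> 1"
    unfolding deg_def by (metis card_mono card.empty card_insert_disjoint finite.emptyI finite.insertI empty_iff One_nat_def)
  have "{e \<in> ?E. f a \<in> e} \<subseteq> {{f a, f (f a)}}"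
    using insert.hyps by (auto dest: inj)
  then have deg_fa: "deg ?E (f a) \<le> 1"
    unfolding deg_def by (metis card_mono card.empty card_insert_disjoint finite.emptyI finite.insertI empty_iff One_nat_def)
  \<comment> \<open>The forward walk from \<open>f a\<close>, continued as long as it leaves from
    points of \<open>A\<close>; its last point may lie outside \<open>A\<close>.\<close>
  define S where "S = {y. \<exists>j. y = (f ^^ j) (f a) \<and> (\<forall>i<j. (f ^^ i) (f a) \<in> A)}"
  have "a \<notin> S"
  proof
    assume "a \<in> S"
    then obtain j where j: "a = (f ^^ j) (f a)" "\<forall>i<j. (f ^^ i) (f a) \<in> A" by (auto simp: S_def)
    define B where "B = (\<lambda>i. (f ^^ i) (f a)) ` {..j}"
    have "(f ^^ i) (f a) \<in> insert a A" if "i \<le> j" for i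
      using j that by (cases "i = j") auto
    then have "B \<subseteq> insert a A" by (auto simp: B_def)
    moreover have "f ((f ^^ i) (f a)) \<in> B" if "i \<le> j" for i
    proof (cases "i = j")
      case True
      then have "f ((f ^^ i) (f a)) = (f ^^ 0) (f a)" using j(1) by simp
      then show ?thesis unfolding B_def by blast
    next
      case False
      then have "f ((f ^^ i) (f a)) = (f ^^ Suc i) (f a)" "Suc i \<le> j" using that by auto
      then show ?thesis unfolding B_def by blast
    qed
    then have "f ` B \<subseteq> B" by (auto simp: B_def)
    ultimately have "B = {}" by (rule insert.prems)
    then show False by (simp add: B_def)
  qed
  moreover have "f a \<in> S" unfolding S_def by (auto intro!: exI[of _ 0])
  moreover have "x \<in> S \<longleftrightarrow> f x \<in> S" if x: "x \<in> A" for x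
  proof
    assume "x \<in> S"
    then obtain j where j: "x = (f ^^ j) (f a)" "\<forall>i<j. (f ^^ i) (f a) \<in> A" by (auto simp: S_def)
    have "f x = (f ^^ Suc j) (f a)" using j by simp
    moreover have "\<forall>i<Suc j. (f ^^ i) (f a) \<in> A" using j x by (auto simp: less_Suc_eq)
    ultimately show "f x \<in> S" unfolding S_def by blast
  next
    assume "f x \<in> S"
    then obtain j where j: "f x = (f ^^ j) (f a)" "\<forall>i<j. (f ^^ i) (f a) \<in> A" by (auto simp: S_def)
    show "x \<in> S"
    proof (cases j)
      case 0
      then show ?thesis using j x inj[of x a] insert.hyps by simp
    next
      case (Suc i)
      then have "x = (f ^^ i) (f a)" using j(1) inj[of x "(f ^^ i) (f a)"] by simp
      then show ?thesis using j(2) Suc unfolding S_def by auto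
    qed
  qed
  ultimately have "separated ?E (f a) a"
    unfolding separated_def by (intro exI[of _ S]) auto
  from linear_edges.insert[OF lin_E deg_fa deg_a this] show ?case by (simp add: insert_commute)
qed

section \<open>From permutation orbits to the \<open>k + 2\<close> forests\<close>

lemma orbit_is_cycle:
  assumes p: "p permutes verts G" and "finite (verts G)" "v \<in> verts G"
    and edge: "\<And>u. u \<in> verts G \<Longrightarrow> {u, p u} \<in> edges G"
    and ne: "p v \<noteq> v" "p (p v) \<noteq> v"
  obtains vs where "is_cycle G vs" "set vs = orbit p v"
proof -
  define m where "m = least_power p v"
  have perm: "permutation p" using p assms(2) permutation_permutes by blast
  have m: "(p ^^ m) v = v" "m > 0" unfolding m_def by (rule least_power_of_permutation[OF perm])+
  have "m \<noteq> 1" "m \<noteq> 2" using m ne by (auto simp: numeral_2_eq_2)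
  with m(2) have m3: "m \<ge> 3" by linarith
  define vs where "vs = map (\<lambda>j. (p ^^ j) v) [0..<m]"
  have inV: "(p ^^ j) v \<in> verts G" for j
    using p assms(3) by (induction j) (auto simp: permutes_in_image)
  have "distinct vs"
    unfolding vs_def m_def by (rule cycle_of_permutation[OF perm])
  moreover have "{vs ! i, vs ! (Suc i mod length vs)} \<in> edges G" if "i < length vs" for i
  proof -
    have "vs ! (Suc i mod length vs) = p ((p ^^ i) v)"
    proof (cases "Suc i = m")
      case True
      then have "p ((p ^^ i) v) = v" using m(1) by auto
      then show ?thesis using True m(2) by (simp add: vs_def)
    next
      case False
      then show ?thesis using that by (simp add: vs_def)
    qed
    then show ?thesis using that edge[OF inV, of i] by (simp add: vs_def)
  qed
  ultimately have "is_cycle G vs"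
    unfolding is_cycle_def using m3 inV by (auto simp: vs_def)
  moreover have "set vs = orbit p v"
  proof -
    have "orbit p v = {(p ^^ n) v | n. n < m}"
      using orbit_altdef_bounded[OF m] by simp
    then show ?thesis by (auto simp: vs_def)
  qed
  ultimately show ?thesis by (rule that)
qed

theorem theorem4:
  fixes G :: "'a graph" and k :: nat
  assumes "k \<ge> 1"
    and "finite (verts G)"
    and "simple_graph G"
    and "regular G (2 * k)"
    and "girth G \<ge> enat k"
  shows "linear_arboricity G \<le> enat (k + 2)"
proof -
  let ?V = "verts G" and ?E = "edges G"
  have edge: "e \<subseteq> ?V \<and> card e = 2" if "e \<in> ?E" for e using assms(3) that by (auto simp: simple_graph_def)
  have deg: "deg ?E v = 2 * k" if "v \<in> ?V" for v
    using assms(4) that by (simp add: regular_def degree_def deg_def)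
  obtain f where f: "\<And>i. i < k \<Longrightarrow> f i permutes ?V"
    "bij_betw (\<lambda>(v, i). {v, f i v}) (?V \<times> {..<k}) ?E"
    by (rule two_factorization[OF assms(2) edge deg]) auto
  define X where "X = ?V \<times> {..<k}"
  define e where "e = (\<lambda>(v, i). {v, f i v})"
  have e_inj: "inj_on e X" and eX: "e ` X = ?E" using f(2) by (auto simp: bij_betw_def X_def e_def)
  have finX: "finite X" using assms(2) by (simp add: X_def)
  \<comment> \<open>The index is kept because different permutations may have the same orbit as a
    set.\<close>
  define c where "c = (\<lambda>(v, i). (orbit (f i) v, i))"
  have perm: "permutation (f i)" if "i < k" for i using f(1)[OF that] assms(2) permutation_permutes by blast
  interpret partitioned_hypergraph X c e 2 2
    by standard (use finX edge eX in auto)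
  have classes: "k \<le> card {y \<in> X. c y = c x}" if x: "x \<in> X" for x
  proof -
    obtain v i where vi: "x = (v, i)" "v \<in> ?V" "i < k" using x by (auto simp: X_def)
    have in_V: "f i u \<in> ?V" if "u \<in> ?V" for u using f(1)[OF vi(3)] that by (simp add: permutes_in_image)
    have arc: "{u, f i u} \<in> ?E" if "u \<in> ?V" for u using eX that vi by (force simp: X_def e_def)
    have neq: "f i v \<noteq> v" using edge[OF arc[OF vi(2)]] by auto
    \<comment> \<open>An orbit of size two would make two arcs represent the same edge.\<close>
    have neq2: "f i (f i v) \<noteq> v"
    proof
      assume "f i (f i v) = v"
      then have "e (v, i) = e (f i v, i)" by (auto simp: e_def)
      then show False using e_inj vi in_V neq by (auto simp: inj_on_def X_def)
    qed
    obtain vs where vs: "is_cycle G vs" "set vs = orbit (f i) v"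
      by (rule orbit_is_cycle[OF f(1)[OF vi(3)] assms(2) vi(2) arc neq neq2]) auto
    have "enat k \<le> enat (length vs)"
      using assms(5) vs(1) unfolding girth_def by (meson INF_lower mem_Collect_eq order_trans)
    then have "k \<le> card (set vs \<times> {i})"
      using vs(1) by (simp add: is_cycle_def distinct_card)
    also have "set vs \<times> {i} \<subseteq> {y \<in> X. c y = c x}"
    proof
      fix y assume "y \<in> set vs \<times> {i}"
      then obtain u where u: "y = (u, i)" "u \<in> set vs" by auto
      then have "orbit (f i) u = orbit (f i) v"
        using orbit_cyclic_eq3[OF cyclic_on_orbit'[OF perm[OF vi(3)]]] vs(2) by metis
      moreover have "u \<in> ?V" using vs(1) u by (auto simp: is_cycle_def)
      ultimately show "y \<in> {y \<in> X. c y = c x}" using u vi by (simp add: X_def c_def)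
    qed
    then have "card (set vs \<times> {i}) \<le> card {y \<in> X. c y = c x}"
      using finX by (intro card_mono) auto
    finally show ?thesis .
  qed
  have degree: "card {x \<in> X. v \<in> e x} \<le> 2 * k" for v
  proof -
    have "card {x \<in> X. v \<in> e x} = card (e ` {x \<in> X. v \<in> e x})"
      by (rule card_image[symmetric]) (rule inj_on_subset[OF e_inj], auto)
    also have "e ` {x \<in> X. v \<in> e x} = {e \<in> ?E. v \<in> e}" using eX by auto
    finally have eq: "card {x \<in> X. v \<in> e x} = deg ?E v" by (simp add: deg_def)
    show ?thesis
    proof (cases "v \<in> ?V")
      case False
      then have empty: "{e \<in> ?E. v \<in> e} = {}" using edge by auto
      show ?thesis unfolding eq deg_def empty by simp
    qed (simp add: eq deg)
  qed
  obtain T where T: "T \<subseteq> X" "\<And>x. x \<in> X \<Longrightarrow> \<exists>y\<in>T. c y = c x"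
    "\<And>v. card {x \<in> T. v \<in> e x} < 2 + 2"
    by (rule bounded_degree_transversal[of k]) (use classes degree assms(1) in auto)
  have finT: "finite T" using T(1) finX finite_subset by blast
  have "deg (e ` T) v \<le> 3" for v
  proof -
    have "{d \<in> e ` T. v \<in> d} = e ` {x \<in> T. v \<in> e x}" by auto
    then have "deg (e ` T) v \<le> card {x \<in> T. v \<in> e x}"
      unfolding deg_def using finT by (simp add: card_image_le)
    then show ?thesis using T(3)[of v] by simp
  qed
  moreover have "card d = 2" if "d \<in> e ` T" for d using edge that T(1) eX by auto
  ultimately obtain R B where RB: "linear_edges R" "linear_edges B" "R \<inter> B = {}" "R \<union> B = e ` T"
    using subcubic_linear_arboricity[of "e ` T"] finT by blast
  define Y where "Y i = {x \<in> X - T. snd x = i}" for i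
  have lin_Y: "linear_edges (e ` Y i)" if i: "i < k" for i
  proof -
    let ?A = "{v \<in> ?V. (v, i) \<notin> T}"
    have "linear_edges ((\<lambda>v. {v, f i v}) ` ?A)"
    proof (rule linear_edges_permutation_edges)
      show "inj (f i)" using f(1)[OF i] by (rule permutes_inj)
      show "finite ?A" using assms(2) by simp
      fix B assume B: "B \<subseteq> ?A" "f i ` B \<subseteq> B"
      show "B = {}"
      proof (rule ccontr)
        assume "B \<noteq> {}"
        then obtain v where v: "v \<in> B" by auto
        then have "(v, i) \<in> X" using B i by (auto simp: X_def)
        then obtain y where y: "y \<in> T" "c y = c (v, i)" using T(2) by blast
        obtain u j where uj: "y = (u, j)" by (cases y)
        then have "j = i" "orbit (f i) u = orbit (f i) v" using y by (auto simp: c_def)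
        \<comment> \<open>A nonempty closed set contains a whole orbit, but \<open>T\<close>
          contains an arc of every orbit.\<close>
        then have u: "u \<in> orbit (f i) v" using permutation_self_in_orbit[OF perm[OF i], of u] by simp
        have "orbit (f i) v \<subseteq> B"
        proof
          fix w assume "w \<in> orbit (f i) v"
          then show "w \<in> B" by induction (use B v in auto)
        qed
        then show False using u B uj y \<open>j = i\<close> by auto
      qed
    qed
    moreover have "e ` Y i = (\<lambda>v. {v, f i v}) ` ?A"
      using i by (force simp: Y_def X_def e_def)
    ultimately show ?thesis by simp
  qed
  \<comment> \<open>Indices below \<open>k\<close> hold what is left of the factors;
    \<open>k\<close> and \<open>k + 1\<close> hold the two forests made of the removed
    edges.\<close>
  define D where "D i = (if i < k then e ` Y i else if i = k then R else B)" for i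
  define F where "F i = \<lparr>verts = ?V, edges = D i\<rparr>" for i
  have YX: "(\<Union>i<k. Y i) = X - T" by (auto simp: Y_def X_def)
  have split: "{..<k + 2} = {..<k} \<union> {k, Suc k}" by auto
  have "(\<Union>i<k + 2. D i) = (\<Union>i<k. e ` Y i) \<union> (R \<union> B)"
    unfolding split by (auto simp: D_def)
  also have "(\<Union>i<k. e ` Y i) = e ` (X - T)" unfolding YX[symmetric] by auto
  finally have UN: "(\<Union>i<k + 2. D i) = ?E"
    unfolding RB(4) image_Un[symmetric] using eX T(1) by (simp add: Un_absorb2)
  have YY: "e ` Y i \<inter> e ` Y j = {}" if "i \<noteq> j" for i j
    using inj_on_image_Int[OF e_inj, of "Y i" "Y j"] that by (auto simp: Y_def)
  have YT: "e ` Y i \<inter> e ` T = {}" for i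
    using inj_on_image_Int[OF e_inj, of "Y i" T] T(1) by (auto simp: Y_def)
  have YRB: "e ` Y i \<inter> R = {}" "e ` Y i \<inter> B = {}" for i
    using YT[of i] unfolding RB(4)[symmetric] Int_Un_distrib Un_empty by (rule conjunct1, rule conjunct2)
  have disj: "D i \<inter> D j = {}" if ij: "i < k + 2" "j < k + 2" "i < j" for i j
  proof -
    consider "i < k" "j < k" | "i < k" "j = k" | "i < k" "j = Suc k" | "i = k" "j = Suc k"
      using ij by linarith
    then show ?thesis using YY[of i j] YRB[of i] RB(3) ij by cases (simp_all add: D_def)
  qed
  have "disjoint_family_on D {..<k + 2}"
    unfolding disjoint_family_on_def
    using disj by (metis Int_commute lessThan_iff linorder_neqE_nat)
  moreover have "linear_forest (F i)" if "i < k + 2" for i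
  proof -
    have "linear_edges (D i)" using lin_Y RB by (simp add: D_def)
    moreover have "\<Union>(D i) \<subseteq> ?V" using UN that edge by blast
    ultimately show ?thesis unfolding F_def by (rule linear_forest_if_linear_edges)
  qed
  ultimately have "linear_decomposition G (k + 2) F"
    using UN by (simp add: linear_decomposition_def F_def)
  then show ?thesis unfolding linear_arboricity_def by (intro INF_lower) auto
qed

end
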